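(* Let $n\geq 1$ and $q\geq 1$ be integers. Let $L$ be an $m$-component link in $S^3$ and let $\lambda_i$ be its $i$th longitude word $(1\leq i\leq m)$ obtained from a diagram of $L$. Let $O$ be the trivial $m$-component link. If the groups $\mathcal{R}_4(L)$ and $\mathcal{R}_4(O)$ are isomorphic, then the set $\{[\alpha_i,\eta_q(\lambda_i)]\mid 1\leq i\leq m\}$ is a subset of the normal subgroup $\langle\langle S(A)\rangle\rangle\cdot\langle\langle W_n(A)\rangle\rangle\cdot\Gamma_qF(A)$ of $F(A)$.
   Context: All links are ordered and oriented links in $S^3$. For a set $X$, $F(X)$ denotes the free group on the alphabet $X^{\pm}=\{x,x^{-1}\mid x\in X\}$. Commutators are $[a,b]=a^{-1}b^{-1}ab$. For a group $G$, $\Gamma_qG$ is the $q$th term of the lower central series of $G$ ($\Gamma_1G=G$). $\langle\langle\,\cdot\,\rangle\rangle$ denotes normal closure, and for normal subgroups $H,I$ of $G$, $H\cdot I$ is the subgroup generated by all $ab$ with $a\in H$, $b\in I$. For a set $X$ and an integer $n\ge1$ put $$S(X)=\{(awbw^{-1})^2(wbw^{-1}a)^{-2}\mid a,b\in X^{\pm},\ w\in F(X)\}\subset F(X),\qquad W_n(X)=\{w^n\mid w\in F(X)\}\subset F(X).$$ The Dabkowski-Sahi invariant: let $\langle X\mid R\rangle$ be a Wirtinger presentation of the fundamental group $G(L)$ of the complement $S^3\setminus L$. Then $\mathcal{R}_4(L)$ is the group with presentation $\langle X\mid R,S(X)\rangle$. Longitude words and the maps $\eta_q$. Take a diagram of the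 $m$-component link $L$. For each $i$, choose one arc of the $i$th component and call it $x_{i1}$; let $x_{i2},\ldots,x_{ir_i}$ be the other arcs of the $i$th component met in turn following the orientation, where $r_i$ is the number of arcs of the $i$th component (an arc goes from one under-crossing to the next). Let $X=\{x_{ij}\mid 1\le i\le m,\ 1\le j\le r_i\}$. Let $u_{ij}\in X$ be the over-passing arc at the crossing separating $x_{ij}$ and $x_{i\,j+1}$ (with $x_{i\,r_i+1}=x_{i1}$), and let $\varepsilon_{ij}\in\{1,-1\}$ be the sign of that crossing. Put $v_{ij}=u_{i1}^{\varepsilon_{i1}}u_{i2}^{\varepsilon_{i2}}\cdots u_{ij}^{\varepsilon_{ij}}\in F(X)$. The $i$th longitude word is $\lambda_i=v_{ir_i}$ (if the $i$th component has no under-crossing, then it is a single arc and $\lambda_i$ is the empty word). In the Wirtinger presentation the relation at this crossing is $x_{i\,j+1}=u_{ij}^{-\varepsilon_{ij}}x_{ij}u_{ij}^{\varepsilon_{ij}}$. Let $A=\{\alpha_1,\ldots,\alpha_m\}$. Homomorphisms $\eta_q:F(X)\to F(A)$, $q\ge1$, are defined inductively by $\eta_1(x_{ij})=\alpha_i$, and $\eta_{q+1}(x_{i1})=\alpha_i$, $\eta_{q+1}(x_{i\,j+1})=\eta_q(v_{ij}^{-1})\,\alpha_i\,\eta_q(v_{ij})$ for $1\le j\le r_i-1$. *)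

theory Defs
  imports "HOL-Analysis.Analysis" "HOL-Algebra.Generated_Groups"
begin

section \<open>Free groups and presentations\<close>

text \<open>
  The letter \<open>(x, True)\<close> is the generator \<open>x\<close> and \<open>(x, False)\<close> is its inverse.  The free
  group on \<open>X\<close> consists of the freely reduced words over \<open>X\<close>.
\<close>

type_synonym 'a word = "('a \<times> bool) list"

fun cancel_cons :: "'a \<times> bool \<Rightarrow> 'a word \<Rightarrow> 'a word" where
  "cancel_cons p [] = [p]"
| "cancel_cons p (q # w) = (if fst p = fst q \<and> snd p \<noteq> snd q then w else p # q # w)"

definition reduce :: "'a word \<Rightarrow> 'a word" where
  "reduce w = foldr cancel_cons w []"

definition reduced :: "'a word \<Rightarrow> bool" where
  "reduced = successively (\<lambda>p q. \<not> (fst p = fst q \<and> snd p \<noteq> snd q))"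

definition free_group :: "'a set \<Rightarrow> 'a word monoid" where
  "free_group X =
     \<lparr>carrier = {w. reduced w \<and> fst ` set w \<subseteq> X}, mult = (\<lambda>u v. reduce (u @ v)), one = []\<rparr>"

definition gen :: "'a \<Rightarrow> 'a word" where
  "gen x = [(x, True)]"

definition signed_letters :: "'a set \<Rightarrow> 'a word set" where
  "signed_letters X = {[(x, s)] | x s. x \<in> X}"

text \<open>The homomorphism from a free group to \<open>G\<close> that extends the map \<open>f\<close> on generators.\<close>

definition free_lift :: "('b, 'c) monoid_scheme \<Rightarrow> ('a \<Rightarrow> 'b) \<Rightarrow> 'a word \<Rightarrow> 'b" where
  "free_lift G f w =
     foldr (\<lambda>(x, s) g. (if s then f x else inv\<^bsub>G\<^esub> (f x)) \<otimes>\<^bsub>G\<^esub> g) w \<one>\<^bsub>G\<^esub>"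

definition normal_closure :: "('a, 'b) monoid_scheme \<Rightarrow> 'a set \<Rightarrow> 'a set" where
  "normal_closure G R = \<Inter>{N. N \<lhd> G \<and> R \<subseteq> N}"

definition presented_group :: "'a set \<Rightarrow> 'a word set \<Rightarrow> 'a word set monoid" where
  "presented_group X R = free_group X Mod normal_closure (free_group X) R"

definition commutator :: "('a, 'b) monoid_scheme \<Rightarrow> 'a \<Rightarrow> 'a \<Rightarrow> 'a" where
  "commutator G a b = inv\<^bsub>G\<^esub> a \<otimes>\<^bsub>G\<^esub> inv\<^bsub>G\<^esub> b \<otimes>\<^bsub>G\<^esub> a \<otimes>\<^bsub>G\<^esub> b"

text \<open>\<open>lower_central G q\<close> is \<open>\<Gamma>\<^sub>q G\<close> for \<open>q \<ge> 1\<close>; the value at \<open>0\<close> is a filler.\<close>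

fun lower_central :: "('a, 'b) monoid_scheme \<Rightarrow> nat \<Rightarrow> 'a set" where
  "lower_central G 0 = carrier G"
| "lower_central G (Suc 0) = carrier G"
| "lower_central G (Suc (Suc q)) =
     generate G {commutator G a b | a b. a \<in> lower_central G (Suc q) \<and> b \<in> carrier G}"

definition subgroup_prod :: "('a, 'b) monoid_scheme \<Rightarrow> 'a set \<Rightarrow> 'a set \<Rightarrow> 'a set" where
  "subgroup_prod G H I = generate G {a \<otimes>\<^bsub>G\<^esub> b | a b. a \<in> H \<and> b \<in> I}"

definition S_words :: "'a set \<Rightarrow> 'a word set" where
  "S_words X = (let F = free_group X in
     {((a \<otimes>\<^bsub>F\<^esub> w \<otimes>\<^bsub>F\<^esub> b \<otimes>\<^bsub>F\<^esub> inv\<^bsub>F\<^esub> w) [^]\<^bsub>F\<^esub> (2::int)) \<otimes>\<^bsub>F\<^esub>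
      ((w \<otimes>\<^bsub>F\<^esub> b \<otimes>\<^bsub>F\<^esub> inv\<^bsub>F\<^esub> w \<otimes>\<^bsub>F\<^esub> a) [^]\<^bsub>F\<^esub> (- 2::int)) | a b w.
      a \<in> signed_letters X \<and> b \<in> signed_letters X \<and> w \<in> carrier F})"

definition W_words :: "nat \<Rightarrow> 'a set \<Rightarrow> 'a word set" where
  "W_words n X = {w [^]\<^bsub>free_group X\<^esub> n | w. w \<in> carrier (free_group X)}"

lemma cancel_cons_reduced: "reduced w \<Longrightarrow> reduced (cancel_cons p w)"
  by (cases w) (auto simp: reduced_def successively_Cons)

lemma reduced_reduce: "reduced (reduce w)"
proof (induction w)
  case Nil then show ?case by (simp add: reduce_def reduced_def)
next
  case (Cons p w) then show ?case using cancel_cons_reduced by (simp add: reduce_def)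
qed

lemma reduce_id: "reduced w \<Longrightarrow> reduce w = w"
proof (induction w)
  case Nil then show ?case by (simp add: reduce_def)
next
  case (Cons p w)
  then have "reduce w = w" by (auto simp: reduced_def successively_Cons)
  with Cons.prems show ?case
    by (cases w) (auto simp: reduce_def reduced_def)
qed

lemma set_cancel_cons: "set (cancel_cons p w) \<subseteq> insert p (set w)"
  by (cases w) auto

lemma set_reduce: "set (reduce w) \<subseteq> set w"
  unfolding reduce_def
proof (induction w)
  case (Cons p w) then show ?case using set_cancel_cons[of p "foldr cancel_cons w []"] by auto
qed auto

lemma cancel_cons_inverse:
  assumes "reduced w" shows "cancel_cons (x, s) (cancel_cons (x, \<not> s) w) = w"
  using assms by (cases w rule: remdups_adj.cases) (auto simp: reduced_def)

lemma foldr_cancel_cons: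
  assumes "reduced w" "reduced v"
  shows "foldr cancel_cons (cancel_cons p w) v = cancel_cons p (foldr cancel_cons w v)"
proof -
  have red: "reduced (foldr cancel_cons u v)" for u
    using assms(2) by (induction u) (auto intro: cancel_cons_reduced)
  show ?thesis
  proof (cases w)
    case (Cons q u)
    have "cancel_cons p (cancel_cons q (foldr cancel_cons u v)) = foldr cancel_cons u v"
      if "fst p = fst q" "snd p \<noteq> snd q"
      using cancel_cons_inverse[OF red, of "fst p" "snd p" u] that
      by (cases p; cases q) auto
    with Cons show ?thesis by auto
  qed auto
qed

lemma foldr_reduce:
  assumes "reduced v" shows "foldr cancel_cons (reduce u) v = foldr cancel_cons u v"
proof (induction u)
  case (Cons p u)
  have "reduce (p # u) = cancel_cons p (reduce u)" by (simp add: reduce_def)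
  then show ?case using foldr_cancel_cons[OF reduced_reduce assms] Cons by simp
qed (simp add: reduce_def)

lemma group_free_group: "group (free_group X)"
proof (rule groupI)
  let ?F = "free_group X"
  have app: "reduce (u @ v) = foldr cancel_cons u (reduce v)" for u v :: "'a word"
    by (simp add: reduce_def)
  fix u v w
  assume u: "u \<in> carrier ?F" and v: "v \<in> carrier ?F"
  show "u \<otimes>\<^bsub>?F\<^esub> v \<in> carrier ?F"
    using u v set_reduce[of "u @ v"] by (fastforce simp: free_group_def reduced_reduce)
  assume w: "w \<in> carrier ?F"
  have "reduce (reduce (u @ v) @ w) = reduce (u @ reduce (v @ w))"
    using foldr_reduce[of "reduce w" "u @ v"] reduced_reduce[of w] reduce_id[OF reduced_reduce, of "v @ w"]
    by (simp add: app)
  then show "u \<otimes>\<^bsub>?F\<^esub> v \<otimes>\<^bsub>?F\<^esub> w = u \<otimes>\<^bsub>?F\<^esub> (v \<otimes>\<^bsub>?F\<^esub> w)"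
    by (simp add: free_group_def)
next
  let ?F = "free_group X"
  fix u assume u: "u \<in> carrier ?F"
  show "\<one>\<^bsub>?F\<^esub> \<otimes>\<^bsub>?F\<^esub> u = u" using u by (simp add: free_group_def reduce_id)
  define u' where "u' = rev (map (\<lambda>(x, s). (x, \<not> s)) u)"
  have "reduced u'"
    using u by (auto simp: u'_def free_group_def reduced_def successively_map split_beta
        simp del: successively_rev elim!: successively_mono simp add: successively_rev)
  moreover have "fst ` set u' \<subseteq> X" using u by (force simp: u'_def free_group_def)
  moreover have "reduce (u' @ u) = []"
  proof -
    have "reduced u" using u by (simp add: free_group_def)
    then have "reduce (rev (map (\<lambda>(x, s). (x, \<not> s)) u) @ u) = []"
    proof (induction u)
      case (Cons p u)
      obtain x s where p: "p = (x, s)" by force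
      have ru: "reduced u" using Cons.prems by (auto simp: reduced_def successively_Cons)
      have "cancel_cons (x, \<not> s) (cancel_cons (x, s) (reduce u)) = reduce u"
        using cancel_cons_inverse[OF reduced_reduce, of x "\<not> s" u] by simp
      then show ?case using Cons.IH[OF ru] by (simp add: p reduce_def)
    qed (simp add: reduce_def)
    then show ?thesis by (simp add: u'_def)
  qed
  ultimately show "\<exists>v\<in>carrier ?F. v \<otimes>\<^bsub>?F\<^esub> u = \<one>\<^bsub>?F\<^esub>"
    by (intro bexI[of _ u']) (auto simp: free_group_def)
qed (auto simp: free_group_def reduced_def)


section \<open>Links and their diagrams\<close>

text \<open>
  Circles are parametrized by 1-periodic maps on the reals; the components of a link are numbered
  \<open>1, \<dots>, m\<close> and oriented by their parametrizations.  \<open>\<real>\<^sup>3\<close> is \<open>complex \<times> real\<close>: the first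
  coordinate is the projection to the plane of the diagram, the second one the height.
  \<open>S\<^sup>3\<close> is the unit sphere of \<open>(complex \<times> real) \<times> real\<close>, and \<open>\<real>\<^sup>3\<close> is embedded
  in it by inverse stereographic projection.
\<close>

type_synonym space3 = "complex \<times> real"
type_synonym space4 = "space3 \<times> real"

definition S3 :: "space4 set" where
  "S3 = sphere 0 1"

definition to_S3 :: "space3 \<Rightarrow> space4" where
  "to_S3 p = ((2 / ((norm p)\<^sup>2 + 1)) *\<^sub>R p, ((norm p)\<^sup>2 - 1) / ((norm p)\<^sup>2 + 1))"

definition closed_curves :: "nat \<Rightarrow> (nat \<Rightarrow> real \<Rightarrow> 'a::topological_space) \<Rightarrow> bool" where
  "closed_curves m K \<longleftrightarrow>
     (\<forall>i\<in>{1..m}. continuous_on UNIV (K i) \<and> (\<forall>t. K i (t + 1) = K i t)) \<and>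
     (\<forall>i\<in>{1..m}. \<forall>k\<in>{1..m}. \<forall>s\<in>{0..<1}. \<forall>t\<in>{0..<1}. K i s = K k t \<longrightarrow> i = k \<and> s = t)"

definition link :: "nat \<Rightarrow> (nat \<Rightarrow> real \<Rightarrow> space4) \<Rightarrow> bool" where
  "link m L \<longleftrightarrow> closed_curves m L \<and> (\<forall>i\<in>{1..m}. range (L i) \<subseteq> S3)"

text \<open>
  Equivalence of ordered oriented links: an ambient isotopy of \<open>S\<^sup>3\<close> takes each component to
  the component with the same number, up to an orientation preserving change of parameter.
\<close>

definition link_equiv ::
    "nat \<Rightarrow> (nat \<Rightarrow> real \<Rightarrow> space4) \<Rightarrow> (nat \<Rightarrow> real \<Rightarrow> space4) \<Rightarrow> bool" where
  "link_equiv m K L \<longleftrightarrow>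
     (\<exists>H :: real \<Rightarrow> space4 \<Rightarrow> space4.
        continuous_on ({0..1} \<times> S3) (\<lambda>(t, x). H t x) \<and>
        (\<forall>t\<in>{0..1}. \<exists>g. homeomorphism S3 S3 (H t) g) \<and>
        (\<forall>x\<in>S3. H 0 x = x) \<and>
        (\<forall>i\<in>{1..m}. \<exists>\<phi> :: real \<Rightarrow> real.
           continuous_on UNIV \<phi> \<and> strict_mono \<phi> \<and> (\<forall>t. \<phi> (t + 1) = \<phi> t + 1) \<and>
           (\<forall>t. H 1 (K i t) = L i (\<phi> t))))"

text \<open>
  A diagram is given by a \<open>C\<^sup>1\<close> link in \<open>\<real>\<^sup>3\<close> in general position with respect to
  the projection: the parametrizing intervals \<open>{0..<1}\<close> are used to represent the points of the
  components.
\<close>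

type_synonym diagram = "nat \<Rightarrow> real \<Rightarrow> space3"

definition points_over :: "nat \<Rightarrow> diagram \<Rightarrow> complex \<Rightarrow> (nat \<times> real) set" where
  "points_over m D z = {(i, s). i \<in> {1..m} \<and> s \<in> {0..<1} \<and> fst (D i s) = z}"

definition planar_velocity :: "diagram \<Rightarrow> nat \<Rightarrow> real \<Rightarrow> complex" where
  "planar_velocity D i t = vector_derivative (\<lambda>s. fst (D i s)) (at t)"

definition cross :: "complex \<Rightarrow> complex \<Rightarrow> real" where
  "cross a b = Re a * Im b - Im a * Re b"

definition under_params :: "nat \<Rightarrow> diagram \<Rightarrow> nat \<Rightarrow> real set" where
  "under_params m D i =
     {s \<in> {0..<1}. \<exists>(k, t)\<in>points_over m D (fst (D i s)). snd (D i s) < snd (D k t)}"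

text \<open>
  The last condition only says that the base points \<open>D i 0\<close> are not under-crossings; the arc of
  the \<open>i\<close>th component that contains \<open>D i 0\<close> is the chosen first arc.
\<close>

definition link_diagram :: "nat \<Rightarrow> diagram \<Rightarrow> bool" where
  "link_diagram m D \<longleftrightarrow>
     closed_curves m D \<and>
     (\<forall>i\<in>{1..m}. D i C1_differentiable_on UNIV \<and> (\<forall>t. planar_velocity D i t \<noteq> 0)) \<and>
     (\<forall>z. finite (points_over m D z) \<and> card (points_over m D z) \<le> 2) \<and>
     finite {z. card (points_over m D z) = 2} \<and>
     (\<forall>z. \<forall>(i, s)\<in>points_over m D z. \<forall>(k, t)\<in>points_over m D z.
        (i, s) \<noteq> (k, t) \<longrightarrow> cross (planar_velocity D i s) (planar_velocity D k t) \<noteq> 0) \<and>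
     (\<forall>i\<in>{1..m}. 0 \<notin> under_params m D i)"

definition diagram_of :: "nat \<Rightarrow> diagram \<Rightarrow> (nat \<Rightarrow> real \<Rightarrow> space4) \<Rightarrow> bool" where
  "diagram_of m D L \<longleftrightarrow> link_diagram m D \<and> link_equiv m L (\<lambda>i t. to_S3 (D i t))"

text \<open>The trivial link: unit circles in the plane with centres \<open>3, 6, \<dots>, 3m\<close>.\<close>

definition trivial_link :: diagram where
  "trivial_link i t = (of_real (3 * real i) + cis (2 * pi * t), 0)"

lemma link_diagram_trivial_link: "link_diagram m trivial_link"
proof -
  have eq: "i = k \<and> s = t"
    if "fst (trivial_link i s) = fst (trivial_link k t)" "s \<in> {0..<1}" "t \<in> {0..<1}" for i k s t
  proof -
    have *: "of_real (3 * real i) + cis (2 * pi * s) = of_real (3 * real k) + cis (2 * pi * t)"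
      using that by (simp add: trivial_link_def)
    have "3 * real i + cos (2 * pi * s) = 3 * real k + cos (2 * pi * t)"
      using arg_cong[OF *, of Re] by simp
    moreover have "\<bar>cos (2 * pi * s)\<bar> \<le> 1" "\<bar>cos (2 * pi * t)\<bar> \<le> 1" by simp_all
    ultimately have "\<bar>3 * real i - 3 * real k\<bar> \<le> 2" by linarith
    then have ik: "i = k" by linarith
    with * have "cis (2 * pi * s) = cis (2 * pi * t)" by simp
    then have "exp (\<i> * of_real (2 * pi * s)) = exp (\<i> * of_real (2 * pi * t))"
      by (simp add: cis_conv_exp)
    then obtain n :: int where "\<i> * of_real (2 * pi * s) = \<i> * of_real (2 * pi * t) + (of_int (2 * n) * pi) * \<i>"
      unfolding exp_eq by blast
    then have "2 * pi * s = 2 * pi * t + 2 * of_int n * pi"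
      by (auto simp: complex_eq_iff)
    then have "s = t + of_int n"
      by (metis (no_types, opaque_lifting) distrib_left mult.assoc mult.commute mult_cancel_left pi_neq_zero zero_neq_numeral)
    moreover from this have "\<bar>real_of_int n\<bar> < 1" using that by auto
    then have "n = 0" by linarith
    ultimately show ?thesis using ik by simp
  qed
  have single: "p = p'" if "p \<in> points_over m trivial_link z" "p' \<in> points_over m trivial_link z" for p p' z
    using eq that unfolding points_over_def by (cases p; cases p') fastforce
  then have fin: "finite (points_over m trivial_link z) \<and> card (points_over m trivial_link z) \<le> 1" for z
  proof (cases "points_over m trivial_link z = {}")
    case False
    then obtain p where "points_over m trivial_link z = {p}" using single[of _ z] by blast
    then show ?thesis by simp
  qed simp
  have vd: "((\<lambda>t. fst (trivial_link i t)) has_vector_derivative (of_real (2 * pi) * \<i> * cis (2 * pi * t))) (at t)" for i t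
  proof -
    have "((\<lambda>z. of_real (3 * real i) + exp (\<i> * (of_real (2 * pi) * z))) has_field_derivative
        (of_real (2 * pi) * \<i> * cis (2 * pi * t))) (at (of_real t))"
      by (auto intro!: derivative_eq_intros simp: cis_conv_exp)
    from has_vector_derivative_real_field[OF this] show ?thesis
      by (simp add: trivial_link_def cis_conv_exp)
  qed
  have vd2: "(trivial_link i has_vector_derivative (of_real (2 * pi) * \<i> * cis (2 * pi * t), 0)) (at t)" for i t
  proof -
    have "(\<lambda>t. (fst (trivial_link i t), 0)) = trivial_link i" by (auto simp: trivial_link_def)
    then show ?thesis
      using has_vector_derivative_Pair[OF vd[of i t] has_vector_derivative_const[of 0]] by metis
  qed
  have c1: "trivial_link i C1_differentiable_on UNIV" for i
    unfolding C1_differentiable_on_def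
    by (intro exI[of _ "\<lambda>t. (of_real (2 * pi) * \<i> * cis (2 * pi * t), 0)"] conjI ballI vd2 continuous_intros)
  have "closed_curves m trivial_link"
    unfolding closed_curves_def
  proof (intro conjI ballI allI impI)
    fix i :: nat and t :: real
    show "continuous_on UNIV (trivial_link i)" using C1_differentiable_imp_continuous_on c1 by blast
    show "trivial_link i (t + 1) = trivial_link i t"
      by (simp add: trivial_link_def distrib_left flip: cis_mult)
  next
    fix i k :: nat and s t :: real
    assume "trivial_link i s = trivial_link k t" "s \<in> {0..<1}" "t \<in> {0..<1}"
    then have "i = k \<and> s = t" using eq[of i s k t] by simp
    then show "i = k" "s = t" by simp_all
  qed
  moreover have "planar_velocity trivial_link i t \<noteq> 0" for i t
    unfolding planar_velocity_def vector_derivative_at[OF vd] by simp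
  moreover have "{z. card (points_over m trivial_link z) = 2} = {}"
  proof -
    have "card (points_over m trivial_link z) \<noteq> 2" for z using fin[of z] by linarith
    then show ?thesis by simp
  qed
  moreover have "card (points_over m trivial_link z) \<le> 2" for z using fin[of z] by linarith
  moreover have "under_params m trivial_link i = {}" for i
    by (auto simp: under_params_def trivial_link_def)
  ultimately show ?thesis
    unfolding link_diagram_def using c1 fin single by fastforce
qed


section \<open>Wirtinger presentation and longitudes\<close>

text \<open>
  \<open>num_under m D i\<close> is the number of under-crossings of the \<open>i\<close>th component; it is also the number
  of arcs, except that a component without under-crossings is a single arc.  The arc \<open>x\<^sub>i\<^sub>j\<close> is
  represented by the pair \<open>(i, j)\<close>.
\<close>

definition num_under :: "nat \<Rightarrow> diagram \<Rightarrow> nat \<Rightarrow> nat" where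
  "num_under m D i = card (under_params m D i)"

definition num_arcs :: "nat \<Rightarrow> diagram \<Rightarrow> nat \<Rightarrow> nat" where
  "num_arcs m D i = max 1 (num_under m D i)"

definition arcs :: "nat \<Rightarrow> diagram \<Rightarrow> (nat \<times> nat) set" where
  "arcs m D = {(i, j). i \<in> {1..m} \<and> j \<in> {1..num_arcs m D i}}"

text \<open>
  The arc of the \<open>k\<close>th component that contains \<open>D k t\<close>, where \<open>t \<in> {0..<1}\<close> is not the parameter of
  an under-crossing; behind the last under-crossing one is on the first arc again.
\<close>

definition arc_at :: "nat \<Rightarrow> diagram \<Rightarrow> nat \<Rightarrow> real \<Rightarrow> nat \<times> nat" where
  "arc_at m D k t = (k, card {s \<in> under_params m D k. s < t} mod num_arcs m D k + 1)"

definition next_arc :: "nat \<Rightarrow> diagram \<Rightarrow> nat \<Rightarrow> nat \<Rightarrow> nat \<times> nat" where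
  "next_arc m D i j = (i, j mod num_arcs m D i + 1)"

text \<open>The parameter of the crossing that separates \<open>x\<^sub>i\<^sub>j\<close> from the next arc.\<close>

definition under_param :: "nat \<Rightarrow> diagram \<Rightarrow> nat \<Rightarrow> nat \<Rightarrow> real" where
  "under_param m D i j = sorted_list_of_set (under_params m D i) ! (j - 1)"

definition over_point :: "nat \<Rightarrow> diagram \<Rightarrow> nat \<Rightarrow> nat \<Rightarrow> nat \<times> real" where
  "over_point m D i j = (let p = D i (under_param m D i j) in
     THE (k, t). (k, t) \<in> points_over m D (fst p) \<and> snd p < snd (D k t))"

lemma ex1_over_point:
  assumes "link_diagram m D" "i \<in> {1..m}" "s \<in> under_params m D i"
  shows "\<exists>!(k, t). (k, t) \<in> points_over m D (fst (D i s)) \<and> snd (D i s) < snd (D k t)"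
proof -
  let ?P = "points_over m D (fst (D i s))"
  obtain k t where kt: "(k, t) \<in> ?P" "snd (D i s) < snd (D k t)"
    using assms(3) unfolding under_params_def by blast
  have s: "(i, s) \<in> ?P"
    using assms(2,3) by (simp add: under_params_def points_over_def)
  have "finite ?P" "card ?P \<le> 2"
    using assms(1) by (auto simp: link_diagram_def)
  moreover have "card {(i, s), (k, t)} = 2" using kt(2) by (subst card_2_iff) force
  ultimately have "?P = {(i, s), (k, t)}"
    using s kt by (intro card_seteq[symmetric]) auto
  with kt show ?thesis by (intro ex1I[of _ "(k, t)"]) auto
qed

definition over_arc :: "nat \<Rightarrow> diagram \<Rightarrow> nat \<Rightarrow> nat \<Rightarrow> nat \<times> nat" where
  "over_arc m D i j = (case over_point m D i j of (k, t) \<Rightarrow> arc_at m D k t)"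

text \<open>A crossing is positive iff the (over, under) pair of directions is positively oriented.\<close>

definition crossing_sign :: "nat \<Rightarrow> diagram \<Rightarrow> nat \<Rightarrow> nat \<Rightarrow> int" where
  "crossing_sign m D i j = (case over_point m D i j of (k, t) \<Rightarrow>
     if cross (planar_velocity D k t) (planar_velocity D i (under_param m D i j)) > 0
     then 1 else - 1)"

definition wirtinger_relators :: "nat \<Rightarrow> diagram \<Rightarrow> (nat \<times> nat) word set" where
  "wirtinger_relators m D = (let F = free_group (arcs m D) in
     {inv\<^bsub>F\<^esub> (gen (next_arc m D i j)) \<otimes>\<^bsub>F\<^esub>
        ((gen (over_arc m D i j) [^]\<^bsub>F\<^esub> (- crossing_sign m D i j)) \<otimes>\<^bsub>F\<^esub> gen (i, j) \<otimes>\<^bsub>F\<^esub>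
         (gen (over_arc m D i j) [^]\<^bsub>F\<^esub> crossing_sign m D i j)) | i j.
      i \<in> {1..m} \<and> j \<in> {1..num_under m D i}})"

text \<open>The Dabkowski--Sahi invariant, computed from the Wirtinger presentation of a diagram.\<close>

definition R4 :: "nat \<Rightarrow> diagram \<Rightarrow> (nat \<times> nat) word set monoid" where
  "R4 m D = presented_group (arcs m D) (wirtinger_relators m D \<union> S_words (arcs m D))"

text \<open>The word \<open>v\<^sub>i\<^sub>j\<close>, with \<open>v\<^sub>i\<^sub>0\<close> the empty word.\<close>

primrec partial_longitude :: "nat \<Rightarrow> diagram \<Rightarrow> nat \<Rightarrow> nat \<Rightarrow> (nat \<times> nat) word" where
  "partial_longitude m D i 0 = \<one>\<^bsub>free_group (arcs m D)\<^esub>"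
| "partial_longitude m D i (Suc j) =
     partial_longitude m D i j \<otimes>\<^bsub>free_group (arcs m D)\<^esub>
     (gen (over_arc m D i (Suc j)) [^]\<^bsub>free_group (arcs m D)\<^esub> crossing_sign m D i (Suc j))"

definition longitude :: "nat \<Rightarrow> diagram \<Rightarrow> nat \<Rightarrow> (nat \<times> nat) word" where
  "longitude m D i = partial_longitude m D i (num_under m D i)"

text \<open>
  The generator \<open>\<alpha>\<^sub>i\<close> is represented by the number \<open>i\<close>.  \<open>eta_gen m D q\<close> gives the values of
  \<open>\<eta>\<^sub>q\<close> on the generators; it is not specified for \<open>q = 0\<close>.
\<close>

abbreviation F_alpha :: "nat \<Rightarrow> nat word monoid" where
  "F_alpha m \<equiv> free_group {1..m}"

fun eta_gen :: "nat \<Rightarrow> diagram \<Rightarrow> nat \<Rightarrow> nat \<times> nat \<Rightarrow> nat word" where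
  "eta_gen m D (Suc 0) = (\<lambda>(i, j). gen i)"
| "eta_gen m D (Suc (Suc q)) = (\<lambda>(i, j).
     if j = 1 then gen i
     else free_lift (F_alpha m) (eta_gen m D (Suc q))
            (inv\<^bsub>free_group (arcs m D)\<^esub> (partial_longitude m D i (j - 1))) \<otimes>\<^bsub>F_alpha m\<^esub>
          gen i \<otimes>\<^bsub>F_alpha m\<^esub>
          free_lift (F_alpha m) (eta_gen m D (Suc q)) (partial_longitude m D i (j - 1)))"

definition eta :: "nat \<Rightarrow> diagram \<Rightarrow> nat \<Rightarrow> (nat \<times> nat) word \<Rightarrow> nat word" where
  "eta m D q = free_lift (F_alpha m) (eta_gen m D q)"

end

theory Submission
  imports Defs
begin

text \<open>
  Let \<open>N\<close> be the normal subgroup in question and \<open>Q = F(A)/N\<close>.  Being finitely generated,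
  nilpotent and of finite exponent, \<open>Q\<close> is finite.  It is a quotient of \<open>R\<^sub>4(O)\<close>, hence of
  \<open>R\<^sub>4(L)\<close>, which gives a surjection \<open>\<theta>\<close> from \<open>F(X)\<close> onto \<open>Q\<close> that kills the Wirtinger
  relators and \<open>S(X)\<close>.  Let \<open>\<phi>\<close> send \<open>\<alpha>\<^sub>i\<close> to \<open>\<theta>(x\<^sub>i\<^sub>1)\<close>.  As in Milnor's presentation of
  link groups, \<open>\<phi> \<circ> \<eta>\<^sub>k\<close> agrees with \<open>\<theta>\<close> modulo \<open>\<Gamma>\<^sub>k Q\<close>, and \<open>\<Gamma>\<^sub>q Q\<close> is trivial.  Hence \<open>\<phi>\<close> is
  onto and kills \<open>[\<alpha>\<^sub>i, \<eta>\<^sub>q(\<lambda>\<^sub>i)]\<close>.  It also kills \<open>N\<close>, so it induces a surjective endomorphism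
  of the finite group \<open>Q\<close>; this is injective, and therefore the kernel of \<open>\<phi>\<close> is \<open>N\<close>.
\<close>

section \<open>Homomorphisms from free groups\<close>

lemma one_free_group: "\<one>\<^bsub>free_group X\<^esub> = []"
  by (simp add: free_group_def)

lemma letter_closed: "x \<in> X \<Longrightarrow> [(x, s)] \<in> carrier (free_group X)"
  by (simp add: free_group_def reduced_def)

lemma gen_closed: "x \<in> X \<Longrightarrow> gen x \<in> carrier (free_group X)"
  by (simp add: gen_def letter_closed)

lemma inv_gen:
  assumes "x \<in> X"
  shows "inv\<^bsub>free_group X\<^esub> (gen x) = [(x, False)]"
proof -
  interpret group "free_group X" by (rule group_free_group)
  show ?thesis
  proof (rule inv_equality)
    show "[(x, False)] \<otimes>\<^bsub>free_group X\<^esub> gen x = \<one>\<^bsub>free_group X\<^esub>"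
      by (simp add: gen_def free_group_def reduce_def)
  qed (simp_all add: assms gen_closed letter_closed)
qed

text \<open>A reduced word \<open>p # w\<close> is the product of the letter \<open>p\<close> and
  the reduced word \<open>w\<close>, because nothing cancels; induction on the word then writes it
  in terms of generators and their inverses.\<close>

lemma carrier_free_group: "carrier (free_group X) = generate (free_group X) (gen ` X)"
proof -
  interpret group "free_group X" by (rule group_free_group)
  have "w \<in> carrier (free_group X) \<Longrightarrow> w \<in> generate (free_group X) (gen ` X)" for w
  proof (induction w)
    case Nil
    show ?case using generate.one[of "free_group X"] by (simp add: one_free_group)
  next
    case (Cons p w)
    obtain x s where p: "p = (x, s)" by fastforce
    have x: "x \<in> X" and w: "w \<in> carrier (free_group X)"
      using Cons.prems by (auto simp: p free_group_def reduced_def successively_Cons)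
    have "[p] \<in> generate (free_group X) (gen ` X)"
    proof (cases s)
      case True
      then have "[p] = gen x" by (simp add: p gen_def)
      then show ?thesis using x generate.incl[of "gen x" "gen ` X"] by simp
    next
      case False
      then have "[p] = inv\<^bsub>free_group X\<^esub> gen x" using inv_gen[OF x] by (simp add: p)
      then show ?thesis using x generate.inv[of "gen x" "gen ` X" "free_group X"] by simp
    qed
    moreover have "[p] \<otimes>\<^bsub>free_group X\<^esub> w = p # w"
      using Cons.prems by (simp add: free_group_def reduce_id)
    ultimately show ?case using generate.eng[OF _ Cons.IH[OF w], of "[p]"] by simp
  qed
  moreover have "gen ` X \<subseteq> carrier (free_group X)" using gen_closed[of _ X] by blast
  ultimately show ?thesis using generate_incl[of "gen ` X"] by blast
qed

lemma hom_eq_on_generate: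
  assumes "group G" "group H" "h \<in> hom G H" "k \<in> hom G H" "S \<subseteq> carrier G"
    and eq: "\<And>x. x \<in> S \<Longrightarrow> h x = k x" and "g \<in> generate G S"
  shows "h g = k g"
proof -
  interpret h: group_hom G H h using assms by (simp add: group_hom_def group_hom_axioms_def)
  interpret k: group_hom G H k using assms by (simp add: group_hom_def group_hom_axioms_def)
  show ?thesis
    using \<open>g \<in> generate G S\<close>
  proof induction
    case (inv x)
    then show ?case using eq[OF inv] \<open>S \<subseteq> carrier G\<close> by auto
  next
    case (eng x y)
    then show ?case using h.G.generate_in_carrier[OF \<open>S \<subseteq> carrier G\<close>] by simp
  qed (simp_all add: eq)
qed

text \<open>The uniqueness half of the universal property of free groups;
  \<open>free_lift_hom\<close> and \<open>free_lift_gen\<close> give the existence half.\<close>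

lemma free_group_hom_eq:
  assumes "group H" "h \<in> hom (free_group X) H" "k \<in> hom (free_group X) H"
    and "\<And>x. x \<in> X \<Longrightarrow> h (gen x) = k (gen x)" and "w \<in> carrier (free_group X)"
  shows "h w = k w"
proof (rule hom_eq_on_generate[OF group_free_group assms(1-3)])
  show "gen ` X \<subseteq> carrier (free_group X)" by (auto simp: gen_closed)
  show "w \<in> generate (free_group X) (gen ` X)" using assms(5) carrier_free_group by blast
qed (use assms(4) in auto)

context group
begin

lemma free_lift_Nil [simp]: "free_lift G f [] = \<one>"
  by (simp add: free_lift_def)

lemma free_lift_Cons [simp]:
  "free_lift G f (p # w) = (if snd p then f (fst p) else inv (f (fst p))) \<otimes> free_lift G f w"
  by (simp add: free_lift_def split_beta)

text \<open>The hypothesis concerns the letters of the word instead of a fixed alphabet, so it also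
  serves for the unreduced words that arise before \<open>reduce\<close> is applied.\<close>

lemma free_lift_closed:
  "f \<in> fst ` set w \<rightarrow> carrier G \<Longrightarrow> free_lift G f w \<in> carrier G"
  by (induction w) (auto simp: Pi_iff)

lemma free_lift_append:
  assumes "f \<in> fst ` set (u @ v) \<rightarrow> carrier G"
  shows "free_lift G f (u @ v) = free_lift G f u \<otimes> free_lift G f v"
  using assms
proof (induction u)
  case Nil
  then show ?case using free_lift_closed[of f v] by simp
next
  case (Cons p u)
  have "free_lift G f u \<in> carrier G" "free_lift G f v \<in> carrier G" "f (fst p) \<in> carrier G"
    using Cons.prems free_lift_closed[of f u] free_lift_closed[of f v] by (auto simp: Pi_iff)
  with Cons show ?case by (simp add: m_assoc Pi_iff)
qed

lemma free_lift_cancel_cons: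
  assumes "f \<in> fst ` set (p # w) \<rightarrow> carrier G"
  shows "free_lift G f (cancel_cons p w) = free_lift G f (p # w)"
proof (cases w)
  case (Cons q u)
  have "f (fst q) \<in> carrier G" "free_lift G f u \<in> carrier G"
    using assms free_lift_closed[of f u] by (auto simp: Cons)
  \<comment> \<open>The two orders in which a letter and its inverse can meet.\<close>
  then have "f (fst q) \<otimes> (inv f (fst q) \<otimes> free_lift G f u) = free_lift G f u"
    "inv f (fst q) \<otimes> (f (fst q) \<otimes> free_lift G f u) = free_lift G f u"
    by (simp_all flip: m_assoc)
  then show ?thesis by (cases "snd p"; cases "snd q") (simp_all add: Cons)
qed simp

lemma free_lift_reduce:
  "f \<in> fst ` set w \<rightarrow> carrier G \<Longrightarrow> free_lift G f (reduce w) = free_lift G f w"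
proof (induction w)
  case (Cons p w)
  have "reduce (p # w) = cancel_cons p (reduce w)" by (simp add: reduce_def)
  moreover have "f \<in> fst ` set (p # reduce w) \<rightarrow> carrier G"
    using Cons.prems set_reduce[of w] by auto
  ultimately show ?case using Cons free_lift_cancel_cons[of f p "reduce w"] by simp
qed (simp add: reduce_def)

text \<open>The product is concatenation followed by \<open>reduce\<close>, and
  \<open>free_lift\<close> does not change under free reduction.\<close>

lemma free_lift_hom:
  assumes "f \<in> X \<rightarrow> carrier G"
  shows "free_lift G f \<in> hom (free_group X) G"
proof (rule homI)
  fix u v assume uv: "u \<in> carrier (free_group X)" "v \<in> carrier (free_group X)"
  show "free_lift G f u \<in> carrier G"
    using uv assms by (intro free_lift_closed) (auto simp: free_group_def)
  have "f \<in> fst ` set (u @ v) \<rightarrow> carrier G"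
    using uv assms unfolding free_group_def by fastforce
  then show "free_lift G f (u \<otimes>\<^bsub>free_group X\<^esub> v) = free_lift G f u \<otimes> free_lift G f v"
    by (simp add: free_group_def free_lift_reduce free_lift_append)
qed

lemma free_lift_gen: "f x \<in> carrier G \<Longrightarrow> free_lift G f (gen x) = f x"
  by (simp add: gen_def)

end

lemma group_hom_free_lift:
  assumes "group G" "f \<in> X \<rightarrow> carrier G"
  shows "group_hom (free_group X) G (free_lift G f)"
  using group.free_lift_hom[OF assms] group_free_group assms(1)
  by (simp add: group_hom_def group_hom_axioms_def)

lemma free_lift_signed_letter:
  assumes "\<And>x. x \<in> X \<Longrightarrow> f x \<in> Y" and "a \<in> signed_letters X"
  shows "free_lift (free_group Y) (\<lambda>x. gen (f x)) a \<in> signed_letters Y"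
proof -
  obtain x s where a: "a = [(x, s)]" "x \<in> X" using assms(2) by (auto simp: signed_letters_def)
  have f: "f x \<in> Y" using assms(1) a by blast
  interpret group "free_group Y" by (rule group_free_group)
  have "free_lift (free_group Y) (\<lambda>x. gen (f x)) a = [(f x, s)]"
    using inv_gen[OF f] letter_closed[OF f] by (simp add: a gen_def)
  then show ?thesis using f by (auto simp: signed_letters_def)
qed

section \<open>The word sets S(X) and W_n(X)\<close>

lemma signed_letters_closed: "a \<in> signed_letters X \<Longrightarrow> a \<in> carrier (free_group X)"
  using letter_closed by (fastforce simp: signed_letters_def)

lemma S_words_closed: "S_words X \<subseteq> carrier (free_group X)"
proof -
  interpret group "free_group X" by (rule group_free_group)
  show ?thesis by (auto simp: S_words_def Let_def signed_letters_closed)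
qed

text \<open>The entries \<open>a\<close> and \<open>b\<close> of such a word are single letters, so
  this needs a homomorphism that takes generators to generators; the entry \<open>w\<close> is
  arbitrary and causes no restriction.\<close>

lemma S_words_free_lift:
  assumes "\<And>x. x \<in> X \<Longrightarrow> f x \<in> Y" and "u \<in> S_words X"
  shows "free_lift (free_group Y) (\<lambda>x. gen (f x)) u \<in> S_words Y"
proof -
  let ?h = "free_lift (free_group Y) (\<lambda>x. gen (f x))"
  interpret h: group_hom "free_group X" "free_group Y" ?h
    using assms(1) by (intro group_hom_free_lift group_free_group) (auto simp: gen_closed)
  obtain a b w where u: "u =
      ((a \<otimes>\<^bsub>free_group X\<^esub> w \<otimes>\<^bsub>free_group X\<^esub> b \<otimes>\<^bsub>free_group X\<^esub> inv\<^bsub>free_group X\<^esub> w)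
         [^]\<^bsub>free_group X\<^esub> (2::int)) \<otimes>\<^bsub>free_group X\<^esub>
      ((w \<otimes>\<^bsub>free_group X\<^esub> b \<otimes>\<^bsub>free_group X\<^esub> inv\<^bsub>free_group X\<^esub> w \<otimes>\<^bsub>free_group X\<^esub> a)
         [^]\<^bsub>free_group X\<^esub> (- 2::int))"
    and ab: "a \<in> signed_letters X" "b \<in> signed_letters X" and w: "w \<in> carrier (free_group X)"
    using assms(2) unfolding S_words_def Let_def by blast
  note cl = ab[THEN signed_letters_closed] w
  have "?h u =
      ((?h a \<otimes>\<^bsub>free_group Y\<^esub> ?h w \<otimes>\<^bsub>free_group Y\<^esub> ?h b \<otimes>\<^bsub>free_group Y\<^esub> inv\<^bsub>free_group Y\<^esub> ?h w)
         [^]\<^bsub>free_group Y\<^esub> (2::int)) \<otimes>\<^bsub>free_group Y\<^esub>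
      ((?h w \<otimes>\<^bsub>free_group Y\<^esub> ?h b \<otimes>\<^bsub>free_group Y\<^esub> inv\<^bsub>free_group Y\<^esub> ?h w \<otimes>\<^bsub>free_group Y\<^esub> ?h a)
         [^]\<^bsub>free_group Y\<^esub> (- 2::int))"
    using cl by (simp add: u h.hom_int_pow)
  moreover have "?h a \<in> signed_letters Y" "?h b \<in> signed_letters Y"
    using free_lift_signed_letter[of X f Y] assms(1) ab by blast+
  ultimately show ?thesis
    using h.hom_closed[OF w] unfolding S_words_def Let_def by blast
qed

lemma W_words_closed: "W_words n X \<subseteq> carrier (free_group X)"
proof -
  interpret group "free_group X" by (rule group_free_group)
  show ?thesis by (auto simp: W_words_def)
qed

section \<open>Normal subgroups and the lower central series\<close>

context group
begin

lemma normal_closure_normal: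
  assumes "R \<subseteq> carrier G"
  shows "normal_closure G R \<lhd> G"
proof -
  \<comment> \<open>The intersected family has to be nonempty; this is where \<open>R\<close> is
    required to lie in the group.\<close>
  have "carrier G \<in> {N. N \<lhd> G \<and> R \<subseteq> N}"
    using assms by (auto simp: normal_inv_iff subgroup_self)
  then have "{N. N \<lhd> G \<and> R \<subseteq> N} \<noteq> {}" by blast
  then have "subgroup (normal_closure G R) G"
    unfolding normal_closure_def by (intro subgroups_Inter) (auto simp: normal_inv_iff)
  then show ?thesis
    by (auto simp: normal_inv_iff normal_closure_def)
qed

lemma subset_normal_closure: "R \<subseteq> normal_closure G R"
  by (auto simp: normal_closure_def)

lemma normal_closure_minimal: "N \<lhd> G \<Longrightarrow> R \<subseteq> N \<Longrightarrow> normal_closure G R \<subseteq> N"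
  by (auto simp: normal_closure_def)

text \<open>The set of products \<open>a \<otimes> b\<close> is closed under conjugation, so it
  generates a normal subgroup; taking one factor to be the unit gives the two inclusions.\<close>

lemma
  assumes "H \<lhd> G" "I \<lhd> G"
  shows subgroup_prod_normal: "subgroup_prod G H I \<lhd> G"
    and subset_subgroup_prod1: "H \<subseteq> subgroup_prod G H I"
    and subset_subgroup_prod2: "I \<subseteq> subgroup_prod G H I"
proof -
  interpret H: normal H G by fact
  interpret I: normal I G by fact
  let ?P = "{a \<otimes> b | a b. a \<in> H \<and> b \<in> I}"
  have conj: "g \<otimes> (a \<otimes> b) \<otimes> inv g = (g \<otimes> a \<otimes> inv g) \<otimes> (g \<otimes> b \<otimes> inv g)"
    if "a \<in> H" "b \<in> I" "g \<in> carrier G" for a b g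
    using that by (simp add: inv_solve_left m_assoc)
  show "subgroup_prod G H I \<lhd> G"
    unfolding subgroup_prod_def
  proof (rule normal_generateI)
    fix h g assume "h \<in> ?P" and g: "g \<in> carrier G"
    then obtain a b where ab: "h = a \<otimes> b" "a \<in> H" "b \<in> I" by blast
    then show "g \<otimes> h \<otimes> inv g \<in> ?P"
      using conj[OF ab(2,3) g] H.inv_op_closed2[OF g ab(2)] I.inv_op_closed2[OF g ab(3)] by auto
  qed auto
  have "a \<in> ?P" if "a \<in> H" for a
  proof -
    have "a = a \<otimes> \<one>" using that by simp
    then show ?thesis using that I.one_closed by blast
  qed
  then show "H \<subseteq> subgroup_prod G H I"
    using generate.incl[of _ ?P G] unfolding subgroup_prod_def by blast
  have "b \<in> ?P" if "b \<in> I" for b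
  proof -
    have "b = \<one> \<otimes> b" using that by simp
    then show ?thesis using that H.one_closed by blast
  qed
  then show "I \<subseteq> subgroup_prod G H I"
    using generate.incl[of _ ?P G] unfolding subgroup_prod_def by blast
qed

lemma commutator_closed:
  "a \<in> carrier G \<Longrightarrow> b \<in> carrier G \<Longrightarrow> commutator G a b \<in> carrier G"
  by (simp add: commutator_def)

text \<open>The hypothesis has the form in which the Wirtinger relations yield it after one full
  turn around a component.\<close>

lemma commutator_eq_one:
  assumes "a \<in> carrier G" "b \<in> carrier G" "inv b \<otimes> a \<otimes> b = a"
  shows "commutator G a b = \<one>"
proof -
  have "commutator G a b = inv a \<otimes> (inv b \<otimes> a \<otimes> b)"
    using assms(1,2) by (simp add: commutator_def m_assoc)
  then show ?thesis using assms by simp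
qed

lemma conj_commutator:
  assumes "a \<in> carrier G" "b \<in> carrier G" "g \<in> carrier G"
  shows "g \<otimes> commutator G a b \<otimes> inv g =
    commutator G (g \<otimes> a \<otimes> inv g) (g \<otimes> b \<otimes> inv g)"
proof -
  have "inv g \<otimes> (g \<otimes> x) = x" if "x \<in> carrier G" for x
    using that assms(3) by (simp flip: m_assoc)
  then show ?thesis
    using assms by (simp add: commutator_def inv_mult_group m_assoc)
qed

text \<open>A conjugate of a commutator is the commutator of the conjugates, and the first entry
  stays in the previous term by induction.\<close>

lemma lower_central_Suc_normal: "lower_central G (Suc q) \<lhd> G"
proof (induction q)
  case 0
  show ?case by (simp add: normal_inv_iff subgroup_self)
next
  case (Suc q)
  interpret N: normal "lower_central G (Suc q)" G by (rule Suc)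
  show ?case
    unfolding lower_central.simps
  proof (rule normal_generateI)
    fix h g
    assume "h \<in> {commutator G a b |a b. a \<in> lower_central G (Suc q) \<and> b \<in> carrier G}"
      and g: "g \<in> carrier G"
    then obtain a b where h: "h = commutator G a b" "a \<in> lower_central G (Suc q)" "b \<in> carrier G"
      by blast
    then show "g \<otimes> h \<otimes> inv g \<in> {commutator G a b |a b. a \<in> lower_central G (Suc q) \<and> b \<in> carrier G}"
      using conj_commutator[of a b g] N.inv_op_closed2[OF g h(2)] g by auto
  qed (auto intro!: commutator_closed)
qed

lemma lower_central_normal: "lower_central G q \<lhd> G"
  \<comment> \<open>The filler value at index 0 coincides with the first term.\<close>
  using lower_central_Suc_normal lower_central_Suc_normal[of 0] by (cases q) auto

lemma commutator_in_lower_central: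
  assumes "1 \<le> q" "a \<in> lower_central G q" "b \<in> carrier G"
  shows "commutator G a b \<in> lower_central G (Suc q)"
  using assms by (cases q) (auto intro!: generate.incl)

end

lemma (in group_hom) hom_commutator:
  "a \<in> carrier G \<Longrightarrow> b \<in> carrier G \<Longrightarrow> h (commutator G a b) = commutator H (h a) (h b)"
  by (simp add: commutator_def)

text \<open>The second entries of the commutators range over the whole target group, and
  surjectivity is what lifts them.\<close>

lemma (in group_hom) lower_central_surj:
  assumes "h ` carrier G = carrier H"
  shows "lower_central H q = h ` lower_central G q"
proof -
  have "lower_central H (Suc q) = h ` lower_central G (Suc q)" for q
  proof (induction q)
    case (Suc q)
    have N: "lower_central G (Suc q) \<subseteq> carrier G"
      using G.lower_central_normal by (meson normal_imp_subgroup subgroup.subset)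
    let ?C = "{commutator G a b |a b. a \<in> lower_central G (Suc q) \<and> b \<in> carrier G}"
    have "{commutator H a b |a b. a \<in> lower_central H (Suc q) \<and> b \<in> carrier H} = h ` ?C"
    proof (intro equalityI subsetI)
      fix x assume "x \<in> {commutator H a b |a b. a \<in> lower_central H (Suc q) \<and> b \<in> carrier H}"
      then obtain a b where "x = commutator H (h a) (h b)" "a \<in> lower_central G (Suc q)" "b \<in> carrier G"
        unfolding Suc assms[symmetric] by blast
      moreover from this have "h (commutator G a b) = x" using N hom_commutator[of a b] by auto
      ultimately show "x \<in> h ` ?C" by (intro image_eqI[of _ _ "commutator G a b"]) auto
    next
      fix x assume "x \<in> h ` ?C"
      then obtain a b where "x = h (commutator G a b)" "a \<in> lower_central G (Suc q)" "b \<in> carrier G"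
        by blast
      moreover from this have "x = commutator H (h a) (h b)" using N hom_commutator[of a b] by auto
      moreover have "h a \<in> lower_central H (Suc q)" "h b \<in> carrier H"
        using calculation Suc by (blast, simp)
      ultimately show "x \<in> {commutator H a b |a b. a \<in> lower_central H (Suc q) \<and> b \<in> carrier H}"
        by blast
    qed
    moreover have "?C \<subseteq> carrier G" using N by (auto intro!: G.commutator_closed)
    ultimately show ?case using generate_img[of ?C] by simp
  qed (simp add: assms)
  then show ?thesis using assms by (cases q) auto
qed

section \<open>Cosets, quotients and presentations\<close>

lemma (in normal) group_hom_Mod: "group_hom G (G Mod H) (\<lambda>x. H #> x)"
  by (intro group_hom.intro group_hom_axioms.intro r_coset_hom_Mod factorgroup_is_group is_group)

lemma (in normal) coset_eq_iff:
  "x \<in> carrier G \<Longrightarrow> y \<in> carrier G \<Longrightarrow> H #> x = H #> y \<longleftrightarrow> x \<otimes> inv y \<in> H"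
  using rcos_module[OF is_group, of y x] rcos_self[OF _ subgroup_axioms, of x]
    repr_independence[OF _ _ subgroup_axioms, of x y] by auto

lemma (in normal) coset_eq_iff_one: "x \<in> carrier G \<Longrightarrow> H #> x = H \<longleftrightarrow> x \<in> H"
  using coset_join1[OF _ _ subgroup_axioms, of x] coset_join2[OF _ subgroup_axioms, of x] by blast

text \<open>Write \<open>a = c \<otimes> b\<close> with \<open>c\<close> in the \<open>k\<close>th
  term. The two conjugates of \<open>x\<close> then differ by a conjugate of the commutator of
  \<open>c\<close> and \<open>inv x\<close>, which lies one term deeper. This gain of one term
  drives the induction for the maps eta.\<close>

lemma (in group) conj_mod_lower_central:
  assumes "1 \<le> k" "a \<in> carrier G" "b \<in> carrier G" "x \<in> carrier G"
    and eq: "lower_central G k #> a = lower_central G k #> b"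
  shows "lower_central G (Suc k) #> (inv a \<otimes> x \<otimes> a) = lower_central G (Suc k) #> (inv b \<otimes> x \<otimes> b)"
proof -
  interpret L: normal "lower_central G k" G by (rule lower_central_normal)
  define M where "M = lower_central G (Suc k)"
  interpret M: normal M G unfolding M_def by (rule lower_central_normal)
  define c where "c = a \<otimes> inv b"
  have c: "c \<in> lower_central G k" "c \<in> carrier G"
    using eq assms(2,3) L.coset_eq_iff[of a b] by (simp_all add: c_def)
  have a: "a = c \<otimes> b" using assms(2,3) by (simp add: c_def m_assoc)
  have "commutator G c (inv x) \<in> M"
    unfolding M_def using assms c by (intro commutator_in_lower_central) auto
  then have "inv b \<otimes> commutator G c (inv x) \<otimes> b \<in> M"
    using assms(3) M.inv_op_closed1 by blast
  moreover have cancel: "b \<otimes> (inv b \<otimes> y) = y" if "y \<in> carrier G" for y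
    using that assms(3) by (simp flip: m_assoc)
  have "inv b \<otimes> commutator G c (inv x) \<otimes> b = (inv a \<otimes> x \<otimes> a) \<otimes> inv (inv b \<otimes> x \<otimes> b)"
    using assms(3,4) c(2) by (simp add: a commutator_def m_assoc inv_mult_group cancel)
  ultimately have "(inv a \<otimes> x \<otimes> a) \<otimes> inv (inv b \<otimes> x \<otimes> b) \<in> M" by simp
  then show ?thesis
    unfolding M_def[symmetric] using M.coset_eq_iff assms(2-4) by simp
qed

lemma (in group) subgroup_prod_minimal:
  "subgroup K G \<Longrightarrow> H \<subseteq> K \<Longrightarrow> I \<subseteq> K \<Longrightarrow> subgroup_prod G H I \<subseteq> K"
  unfolding subgroup_prod_def
  by (intro generate_subgroup_incl) (auto intro: subgroup.m_closed)

text \<open>Finite groups are Hopfian: \<open>h\<close> induces a surjective endomorphism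
  \<open>g\<close> of the finite quotient, so \<open>g\<close> is injective and \<open>h\<close>
  kills nothing outside \<open>H\<close>.\<close>

lemma (in normal) kernel_eq_if_finite_Mod:
  assumes "finite (carrier (G Mod H))" "h \<in> hom G (G Mod H)"
    and surj: "h ` carrier G = carrier (G Mod H)" and "H \<subseteq> kernel G (G Mod H) h"
  shows "kernel G (G Mod H) h = H"
proof
  interpret h: group_hom G "G Mod H" h
    using assms(2) by (intro group_hom.intro group_hom_axioms.intro factorgroup_is_group is_group)
  obtain g where g: "g \<in> hom (G Mod H) (G Mod H)" "\<And>x. x \<in> carrier G \<Longrightarrow> g (H #> x) = h x"
    using h.FactGroup_universal_kernel[OF normal_axioms assms(4)] by blast
  have "g ` carrier (G Mod H) = carrier (G Mod H)"
    unfolding surj[symmetric] by (auto simp: surj carrier_FactGroup g(2) image_image)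
  then have inj: "inj_on g (carrier (G Mod H))"
    using assms(1) by (simp add: eq_card_imp_inj_on)
  show "kernel G (G Mod H) h \<subseteq> H"
  proof
    fix x assume "x \<in> kernel G (G Mod H) h"
    \<comment> \<open>The unit is kept in the form \<open>h \<one>\<close>, since \<open>g\<close>
      is described only by its values on cosets \<open>H #> x\<close>.\<close>
    then have x: "x \<in> carrier G" "h x = h \<one>" by (simp_all add: kernel_def)
    then have "g (H #> x) = g (H #> \<one>)" by (simp add: g(2) del: coset_mult_one)
    then have "H #> x = H #> \<one>"
      using inj x(1) by (auto simp: inj_on_def carrier_FactGroup simp del: coset_mult_one)
    then show "x \<in> H" using x(1) coset_eq_iff_one[of x] coset_eq_iff_one[of \<one>] by simp
  qed
qed fact

text \<open>Von Dyck's theorem: the kernel of \<open>h\<close> is a normal subgroup containing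
  \<open>R\<close>, so it contains the normal closure.\<close>

lemma presented_group_lift:
  assumes "group H" "h \<in> hom (free_group X) H" "R \<subseteq> carrier (free_group X)"
    and "\<And>r. r \<in> R \<Longrightarrow> h r = \<one>\<^bsub>H\<^esub>"
  obtains g where "g \<in> hom (presented_group X R) H"
    "\<And>w. w \<in> carrier (free_group X) \<Longrightarrow>
      g (normal_closure (free_group X) R #>\<^bsub>free_group X\<^esub> w) = h w"
proof -
  interpret group_hom "free_group X" H h
    using assms(1,2) group_free_group by (simp add: group_hom_def group_hom_axioms_def)
  have "R \<subseteq> kernel (free_group X) H h" using assms(3,4) by (auto simp: kernel_def)
  then have "normal_closure (free_group X) R \<subseteq> kernel (free_group X) H h"
    using normal_kernel by (intro G.normal_closure_minimal)
  then show thesis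
    using FactGroup_universal_kernel[OF G.normal_closure_normal[OF assms(3)]] that
    unfolding presented_group_def by blast
qed

section \<open>Finitely generated nilpotent groups of finite exponent are finite\<close>

text \<open>Adding one central generator \<open>z\<close> of exponent \<open>n\<close> enlarges the
  generated group at most \<open>n\<close> times, because powers of \<open>z\<close> can be
  collected in front.\<close>

lemma (in group) finite_generate_central:
  fixes n :: nat
  assumes "finite S" "S \<subseteq> carrier G" "1 \<le> n"
    and "\<And>z g. z \<in> S \<Longrightarrow> g \<in> carrier G \<Longrightarrow> z \<otimes> g = g \<otimes> z"
    and "\<And>z. z \<in> S \<Longrightarrow> z [^] n = \<one>"
  shows "finite (generate G S)"
  using assms(1,2,4,5)
proof (induction S)
  case empty
  show ?case by (simp add: generate_empty)
next
  case (insert z S)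
  have zc: "z \<in> carrier G" using insert.prems by auto
  have comm: "z \<otimes> g = g \<otimes> z" if "g \<in> carrier G" for g using insert.prems that by auto
  have fin: "finite (generate G S)" using insert by auto
  have S: "generate G S \<subseteq> carrier G" using insert.prems generate_incl by auto
  have pow: "z [^] k = z [^] (k mod n)" for k :: nat
  proof -
    have "z [^] k = z [^] (n * (k div n) + k mod n)" by simp
    also have "\<dots> = (z [^] n) [^] (k div n) \<otimes> z [^] (k mod n)"
      using zc by (simp add: nat_pow_mult nat_pow_pow del: mult_div_mod_eq)
    finally show ?thesis using insert.prems zc by simp
  qed
  have comm_pow: "z [^] k \<otimes> g = g \<otimes> z [^] k" if "g \<in> carrier G" for g and k :: nat
    using that comm zc by (induction k) (auto simp: m_assoc, simp flip: m_assoc)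
  \<comment> \<open>A finite set of normal forms, closed under products and inverses of generators
    because exponents of \<open>z\<close> may be reduced modulo \<open>n\<close>.\<close>
  let ?M = "(\<lambda>(k :: nat, y). z [^] k \<otimes> y) ` ({..<n} \<times> generate G S)"
  have M: "z [^] k \<otimes> y \<in> ?M" if "y \<in> generate G S" for y and k :: nat
    using that pow[of k] assms(3) by (intro image_eqI[of _ _ "(k mod n, y)"]) auto
  have "g \<in> ?M" if "g \<in> generate G (insert z S)" for g
    using that
  proof induction
    case one
    show ?case using M[of \<one> 0] generate.one[of G S] by simp
  next
    case (incl h)
    show ?case
    proof (cases "h = z")
      case True
      then show ?thesis using M[of \<one> 1] zc generate.one[of G S] by simp
    next
      case False
      then have "h \<in> generate G S" using incl generate.incl[of h S G] by simp
      then have "z [^] (0::nat) \<otimes> h = h" "h \<in> generate G S" using S by auto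
      then show ?thesis using M by metis
    qed
  next
    case (inv h)
    show ?case
    proof (cases "h = z")
      case True
      have "z [^] (n - 1) \<otimes> z = \<one>"
        using nat_pow_Suc[of z "n - 1"] insert.prems assms(3) by simp
      then have "inv h = z [^] (n - 1)" using zc True by (simp add: inv_equality)
      then show ?thesis using M[of \<one> "n - 1"] zc generate.one[of G S] by simp
    next
      case False
      then have "inv h \<in> generate G S" using inv generate.inv[of h S G] by simp
      then have "z [^] (0::nat) \<otimes> inv h = inv h" "inv h \<in> generate G S" using S by auto
      then show ?thesis using M by metis
    qed
  next
    case (eng g h)
    then obtain k l :: nat and x y where
      gh: "g = z [^] k \<otimes> x" "h = z [^] l \<otimes> y" and xy: "x \<in> generate G S" "y \<in> generate G S"
      by auto
    then have "x \<in> carrier G" "y \<in> carrier G" using S by auto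
    then have "g \<otimes> h = z [^] k \<otimes> (x \<otimes> z [^] l) \<otimes> y" using zc by (simp add: gh m_assoc)
    also have "\<dots> = z [^] k \<otimes> (z [^] l \<otimes> x) \<otimes> y"
      using comm_pow[of x l] \<open>x \<in> carrier G\<close> by simp
    also have "\<dots> = z [^] (k + l) \<otimes> (x \<otimes> y)"
      using \<open>x \<in> carrier G\<close> \<open>y \<in> carrier G\<close> zc by (simp add: m_assoc flip: nat_pow_mult)
    finally show ?case using M generate.eng[OF xy] by metis
  qed
  then have "generate G (insert z S) \<subseteq> ?M" by blast
  moreover have "finite ?M" using fin by simp
  ultimately show ?case by (rule finite_subset)
qed

text \<open>Schreier's argument: the central elements by which \<open>t \<otimes> a\<close> differs from its
  representative generate a finite group \<open>Y\<close>, and \<open>Y T\<close> is closed under right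
  multiplication by the generators.\<close>

lemma (in group) finite_central_extension:
  fixes n :: nat
  assumes "carrier G = generate G S" "finite S" "S \<subseteq> carrier G"
    and "finite T" "T \<subseteq> carrier G" "Z \<subseteq> carrier G" "1 \<le> n"
    and cover: "\<And>g. g \<in> carrier G \<Longrightarrow> \<exists>t\<in>T. g \<otimes> inv t \<in> Z"
    and central: "\<And>z g. z \<in> Z \<Longrightarrow> g \<in> carrier G \<Longrightarrow> z \<otimes> g = g \<otimes> z"
    and exponent: "\<And>z. z \<in> Z \<Longrightarrow> z [^] n = \<one>"
  shows "finite (carrier G)"
proof -
  obtain r where r: "\<And>g. g \<in> carrier G \<Longrightarrow> r g \<in> T \<and> g \<otimes> inv (r g) \<in> Z"
    using cover by metis
  let ?S = "S \<union> m_inv G ` S"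
  \<comment> \<open>The unit is added to the products because \<open>r \<one>\<close> need not be
    \<open>\<one>\<close>; its correction is what puts \<open>\<one>\<close> into \<open>?M\<close>
    at the end.\<close>
  define Y where "Y = (\<lambda>g. g \<otimes> inv (r g)) ` (insert \<one> ((\<lambda>(t, a). t \<otimes> a) ` (T \<times> ?S)))"
  have Sc: "?S \<subseteq> carrier G" using assms(3) by auto
  have YZ: "Y \<subseteq> Z"
  proof -
    have "insert \<one> ((\<lambda>(t, a). t \<otimes> a) ` (T \<times> ?S)) \<subseteq> carrier G"
      using Sc assms(5) by auto
    then show ?thesis using r unfolding Y_def by blast
  qed
  have "finite (generate G Y)"
  proof (rule finite_generate_central[of Y n])
    show "finite Y" using assms(2,4) by (simp add: Y_def)
  qed (use YZ assms(6,7) central exponent in blast)+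
  have Yc: "generate G Y \<subseteq> carrier G" using YZ assms(6) by (intro generate_incl) blast
  let ?M = "(\<lambda>(y, t). y \<otimes> t) ` (generate G Y \<times> T)"
  have letter: "x \<otimes> a \<in> ?M" if "a \<in> ?S" "x \<in> ?M" for a x
  proof -
    obtain y t where x: "x = y \<otimes> t" "y \<in> generate G Y" "t \<in> T" using \<open>x \<in> ?M\<close> by auto
    have yta: "y \<in> carrier G" "t \<in> carrier G" "a \<in> carrier G"
      using x Yc assms(5) Sc that(1) by blast+
    then have "r (t \<otimes> a) \<in> carrier G" using r assms(5) by blast
    note c = yta this
    let ?z = "(t \<otimes> a) \<otimes> inv (r (t \<otimes> a))"
    have "t \<otimes> a = ?z \<otimes> r (t \<otimes> a)" using c by (simp add: m_assoc)
    then have "x \<otimes> a = (y \<otimes> ?z) \<otimes> r (t \<otimes> a)" using c x(1) by (simp add: m_assoc)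
    moreover have "?z \<in> Y" using x(3) that(1) unfolding Y_def by blast
    then have "y \<otimes> ?z \<in> generate G Y" using x(2) generate.incl generate.eng by metis
    moreover have "r (t \<otimes> a) \<in> T" using r c by blast
    ultimately show ?thesis by auto
  qed
  \<comment> \<open>Here \<open>x\<close> is arbitrary in the induction: for a product
    \<open>g \<otimes> h\<close> the second hypothesis is applied to
    \<open>x \<otimes> g\<close>.\<close>
  have "x \<otimes> g \<in> ?M" if "g \<in> generate G S" "x \<in> ?M" for g x
    using that
  proof (induction arbitrary: x)
    case one
    moreover have "x \<in> carrier G" using one Yc assms(5) by auto
    ultimately show ?case by (simp only: r_one)
  next
    case (eng g h)
    moreover have "x \<in> carrier G" using eng.prems Yc assms(5) by auto
    moreover have "g \<in> carrier G" "h \<in> carrier G"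
      using eng.hyps assms(1) by auto
    ultimately show ?case by (metis m_assoc)
  qed (use letter in auto)
  moreover have "\<one> \<in> ?M"
  proof -
    have c: "r \<one> \<in> T" "r \<one> \<in> carrier G" using r[OF one_closed] assms(5) by auto
    have "\<one> \<otimes> inv (r \<one>) \<in> generate G Y" by (intro generate.incl) (simp add: Y_def)
    then show ?thesis using c by (intro image_eqI[of _ _ "(inv (r \<one>), r \<one>)"]) auto
  qed
  ultimately have "carrier G \<subseteq> ?M" using assms(1) by (metis l_one subsetI)
  moreover have "finite ?M" using \<open>finite (generate G Y)\<close> assms(4) by simp
  ultimately show ?thesis by (rule finite_subset)
qed

text \<open>Each step is a central extension: modulo the next term \<open>M\<close>, the image of
  \<open>?L\<close> is central and has exponent \<open>n\<close>, while the quotient by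
  \<open>?L\<close> is finite by induction.\<close>

lemma (in group) finite_Mod_lower_central:
  fixes n :: nat
  assumes "carrier G = generate G S" "finite S" "S \<subseteq> carrier G" "1 \<le> n"
    and exponent: "\<And>g. g \<in> carrier G \<Longrightarrow> g [^] n = \<one>"
  shows "finite (carrier (G Mod lower_central G (Suc q)))"
proof (induction q)
  case 0
  have "carrier (G Mod carrier G) \<subseteq> {carrier G}"
    by (auto simp: carrier_FactGroup coset_join2 subgroup_self)
  then show ?case using finite_subset by auto
next
  case (Suc q)
  let ?L = "lower_central G (Suc q)"
  define M where "M = lower_central G (Suc (Suc q))"
  interpret L: normal ?L G by (rule lower_central_normal)
  interpret M: normal M G unfolding M_def by (rule lower_central_normal)
  let ?p = "\<lambda>x. M #> x"
  interpret p: group_hom G "G Mod M" ?p by (rule M.group_hom_Mod)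
  have p_onto: "carrier (G Mod M) = ?p ` carrier G" by (rule carrier_FactGroup)
  \<comment> \<open>Finitely many representatives, one or more for each coset of
    \<open>?L\<close>.\<close>
  obtain T where T: "T \<subseteq> carrier G" "finite T" "(\<lambda>x. ?L #> x) ` T = carrier (G Mod ?L)"
    using finite_subset_image[OF Suc, of "\<lambda>x. ?L #> x" "carrier G"] by (auto simp: carrier_FactGroup)
  show ?case
    unfolding M_def[symmetric]
  proof (rule p.H.finite_central_extension[of "?p ` S" "?p ` T" "?p ` ?L" n])
    show "carrier (G Mod M) = generate (G Mod M) (?p ` S)"
      using p.generate_img[OF assms(3)] p_onto assms(1) by simp
    show "\<exists>t\<in>?p ` T. g \<otimes>\<^bsub>G Mod M\<^esub> inv\<^bsub>G Mod M\<^esub> t \<in> ?p ` ?L" if g: "g \<in> carrier (G Mod M)" for g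
    proof -
      obtain x where x: "x \<in> carrier G" "g = ?p x" using g p_onto by auto
      have "?L #> x \<in> (\<lambda>x. ?L #> x) ` T" using x(1) T(3) by (simp add: carrier_FactGroup)
      then obtain t where t: "t \<in> T" "?L #> x = ?L #> t" by auto
      then have "x \<otimes> inv t \<in> ?L" using L.coset_eq_iff[of x t] x(1) T(1) by auto
      moreover have "?p (x \<otimes> inv t) = g \<otimes>\<^bsub>G Mod M\<^esub> inv\<^bsub>G Mod M\<^esub> (?p t)"
        using x t T(1) p.hom_mult[of x "inv t"] p.hom_inv[of t] by auto
      ultimately show ?thesis using t(1) by (metis imageI)
    qed
    show "z \<otimes>\<^bsub>G Mod M\<^esub> g = g \<otimes>\<^bsub>G Mod M\<^esub> z" if z: "z \<in> ?p ` ?L" and g: "g \<in> carrier (G Mod M)" for z g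
    proof -
      obtain a where a: "a \<in> ?L" "z = ?p a" using z by auto
      obtain b where b: "b \<in> carrier G" "g = ?p b" using g p_onto by auto
      have ac: "a \<in> carrier G" using a(1) by auto
      \<comment> \<open>With the convention for commutators used here, the inverses make it equal to
        \<open>(a \<otimes> b) \<otimes> inv (b \<otimes> a)\<close>.\<close>
      have "commutator G (inv a) (inv b) \<in> M"
        unfolding M_def using a(1) b(1) by (intro commutator_in_lower_central) auto
      moreover have "commutator G (inv a) (inv b) = (a \<otimes> b) \<otimes> inv (b \<otimes> a)"
        using ac b(1) by (simp add: commutator_def m_assoc inv_mult_group)
      ultimately have "?p (a \<otimes> b) = ?p (b \<otimes> a)"
        using M.coset_eq_iff[of "a \<otimes> b" "b \<otimes> a"] ac b(1) by simp
      then show ?thesis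
        using p.hom_mult[of a b] p.hom_mult[of b a] a(2) b ac by simp
    qed
    show "z [^]\<^bsub>G Mod M\<^esub> n = \<one>\<^bsub>G Mod M\<^esub>" if z: "z \<in> ?p ` ?L" for z
    proof -
      obtain a where a: "a \<in> ?L" "z = ?p a" using z by auto
      then have "z [^]\<^bsub>G Mod M\<^esub> n = ?p (a [^] n)" using p.hom_nat_pow[of a n] by simp
      then show ?thesis using exponent[of a] a(1) p.hom_one by simp
    qed
    show "finite (?p ` S)" "finite (?p ` T)" "1 \<le> n" using assms T by simp_all
    show "?p ` S \<subseteq> carrier (G Mod M)" "?p ` T \<subseteq> carrier (G Mod M)"
        "?p ` ?L \<subseteq> carrier (G Mod M)"
      unfolding p_onto using assms(3) T(1) L.subset by (intro image_mono; blast)+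
  qed
qed

lemma (in group) finite_nilpotent_exponent:
  fixes n :: nat
  assumes "carrier G = generate G S" "finite S" "S \<subseteq> carrier G" "1 \<le> n" "1 \<le> q"
    and "\<And>g. g \<in> carrier G \<Longrightarrow> g [^] n = \<one>" and trivial: "lower_central G q = {\<one>}"
  shows "finite (carrier G)"
proof -
  obtain q' where q: "q = Suc q'" using \<open>1 \<le> q\<close> by (cases q) auto
  interpret N: normal "{\<one>}" G using lower_central_normal[of q] by (simp add: trivial)
  have "finite (carrier (G Mod {\<one>}))"
    using finite_Mod_lower_central[OF assms(1-4,6), of q'] trivial q by metis
  \<comment> \<open>Cosets of the trivial subgroup are singletons, so the quotient is as large as
    \<open>G\<close>.\<close>
  moreover have "inj_on (\<lambda>x. {\<one>} #> x) (carrier G)"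
    by (auto simp: inj_on_def r_coset_def)
  ultimately show ?thesis by (simp add: carrier_FactGroup finite_image_iff)
qed

section \<open>Wirtinger relations and longitudes\<close>

lemma under_param_in_under_params:
  assumes "1 \<le> j" "j \<le> num_under m D i"
  shows "under_param m D i j \<in> under_params m D i"
proof -
  \<comment> \<open>The bounds on \<open>j\<close> make the cardinality positive, which excludes the
    value 0 that \<open>card\<close> takes on infinite sets.\<close>
  have "finite (under_params m D i)"
    using assms by (intro card_ge_0_finite) (simp add: num_under_def)
  then show ?thesis
    using assms nth_mem[of "j - 1" "sorted_list_of_set (under_params m D i)"]
    by (simp add: under_param_def num_under_def)
qed

lemma over_arc_in_arcs:
  assumes "link_diagram m D" "1 \<le> i" "i \<le> m" "1 \<le> j" "j \<le> num_under m D i"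
  shows "over_arc m D i j \<in> arcs m D"
proof -
  let ?s = "under_param m D i j"
  have "\<exists>!(k, t). (k, t) \<in> points_over m D (fst (D i ?s)) \<and> snd (D i ?s) < snd (D k t)"
    using assms by (intro ex1_over_point under_param_in_under_params) auto
  then have "case over_point m D i j of
      (k, t) \<Rightarrow> (k, t) \<in> points_over m D (fst (D i ?s)) \<and> snd (D i ?s) < snd (D k t)"
    unfolding over_point_def Let_def by (rule theI')
  then have "fst (over_point m D i j) \<in> {1..m}"
    by (auto simp: points_over_def)
  moreover have "0 < num_arcs m D k" for k by (simp add: num_arcs_def)
  ultimately show ?thesis
    by (auto simp: over_arc_def arc_at_def arcs_def split_beta intro: Suc_leI)
qed

lemma first_arc_in_arcs: "1 \<le> i \<Longrightarrow> i \<le> m \<Longrightarrow> (i, 1) \<in> arcs m D"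
  by (simp add: arcs_def num_arcs_def)

lemma next_arc_in_arcs: "1 \<le> i \<Longrightarrow> i \<le> m \<Longrightarrow> next_arc m D i j \<in> arcs m D"
  by (auto simp: arcs_def num_arcs_def next_arc_def intro: Suc_leI)

lemma under_arc_in_arcs:
  "1 \<le> i \<Longrightarrow> i \<le> m \<Longrightarrow> 1 \<le> j \<Longrightarrow> j \<le> num_under m D i \<Longrightarrow> (i, j) \<in> arcs m D"
  by (simp add: arcs_def num_arcs_def)

lemma partial_longitude_closed:
  assumes "link_diagram m D" "1 \<le> i" "i \<le> m" "j \<le> num_under m D i"
  shows "partial_longitude m D i j \<in> carrier (free_group (arcs m D))"
proof -
  interpret group "free_group (arcs m D)" by (rule group_free_group)
  show ?thesis
    using assms(4)
  proof (induction j)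
    case (Suc j)
    then have "gen (over_arc m D i (Suc j)) \<in> carrier (free_group (arcs m D))"
      using assms by (intro gen_closed over_arc_in_arcs) auto
    with Suc show ?case by simp
  qed simp
qed

lemma wirtinger_relators_closed:
  assumes "link_diagram m D"
  shows "wirtinger_relators m D \<subseteq> carrier (free_group (arcs m D))"
proof -
  interpret group "free_group (arcs m D)" by (rule group_free_group)
  show ?thesis
    using assms
    by (auto simp: wirtinger_relators_def Let_def gen_closed next_arc_in_arcs over_arc_in_arcs
        under_arc_in_arcs)
qed

lemma eta_gen_closed:
  assumes "link_diagram m D" "1 \<le> i" "i \<le> m" "1 \<le> j" "j \<le> num_arcs m D i"
  shows "eta_gen m D (Suc q) (i, j) \<in> carrier (F_alpha m)"
  using assms(2-)
proof (induction q arbitrary: i j)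
  case 0
  then show ?case by (simp add: gen_closed)
next
  case (Suc q)
  interpret group "F_alpha m" by (rule group_free_group)
  interpret X: group "free_group (arcs m D)" by (rule group_free_group)
  have "eta_gen m D (Suc q) \<in> arcs m D \<rightarrow> carrier (F_alpha m)"
    using Suc.IH by (auto simp: arcs_def)
  from free_lift_hom[OF this]
  have *: "free_lift (F_alpha m) (eta_gen m D (Suc q)) w \<in> carrier (F_alpha m)"
    if "w \<in> carrier (free_group (arcs m D))" for w
    using that by (meson hom_in_carrier)
  \<comment> \<open>This covers a component without under-crossings, whose single arc has
    \<open>j = 1\<close>.\<close>
  have "j - 1 \<le> num_under m D i" using Suc.prems by (simp add: num_arcs_def)
  then have "partial_longitude m D i (j - 1) \<in> carrier (free_group (arcs m D))"
    using assms(1) Suc.prems by (intro partial_longitude_closed)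
  then show ?case using * Suc.prems by (simp add: gen_closed del: One_nat_def)
qed

lemma eta_gen_Pi:
  assumes "link_diagram m D" "1 \<le> q"
  shows "eta_gen m D q \<in> arcs m D \<rightarrow> carrier (F_alpha m)"
  using eta_gen_closed[OF assms(1)] assms(2) by (cases q) (auto simp: arcs_def)

lemma group_hom_eta:
  assumes "link_diagram m D" "1 \<le> q"
  shows "group_hom (free_group (arcs m D)) (F_alpha m) (eta m D q)"
  unfolding eta_def using assms by (intro group_hom_free_lift group_free_group eta_gen_Pi)

text \<open>The setting of Milnor's argument: \<open>\<theta>\<close> amounts to a homomorphism from
  the Wirtinger group of the diagram to any group \<open>G\<close>, which is later the finite
  quotient \<open>Q\<close>.\<close>

locale wirtinger_hom = group_hom "free_group (arcs m D)" G \<theta>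
  for m :: nat and D :: diagram and G (structure) and \<theta> +
  assumes diagram: "link_diagram m D"
    and relators: "r \<in> wirtinger_relators m D \<Longrightarrow> \<theta> r = \<one>"
begin

text \<open>Following the component, each Wirtinger relation conjugates by one more letter of the
  longitude word. The index is cyclic so that the last under-crossing leads back to the first
  arc.\<close>

lemma arc_image:
  assumes "1 \<le> i" "i \<le> m" "j \<le> num_under m D i"
  shows "\<theta> (gen (i, j mod num_arcs m D i + 1)) =
    inv (\<theta> (partial_longitude m D i j)) \<otimes> \<theta> (gen (i, 1)) \<otimes> \<theta> (partial_longitude m D i j)"
  using assms(3)
proof (induction j)
  case 0
  have "\<theta> (gen (i, Suc 0)) \<in> carrier G"
    using first_arc_in_arcs[of i m D] assms by (simp add: gen_closed)
  then show ?case by simp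
next
  case (Suc j)
  let ?u = "gen (over_arc m D i (Suc j))" and ?e = "crossing_sign m D i (Suc j)"
  let ?v = "partial_longitude m D i j" and ?y = "gen (next_arc m D i (Suc j))"
  let ?U = "\<theta> ?u [^]\<^bsub>G\<^esub> ?e"
  \<comment> \<open>There is an under-crossing number \<open>Suc j\<close>, so the
    \<open>max\<close> in \<open>num_arcs\<close> is harmless and the index does not wrap around
    before this crossing.\<close>
  have j: "num_arcs m D i = num_under m D i" "j mod num_arcs m D i + 1 = Suc j"
    using Suc.prems by (auto simp: num_arcs_def)
  have u: "?u \<in> carrier (free_group (arcs m D))"
    using Suc.prems assms diagram by (intro gen_closed over_arc_in_arcs) auto
  have y: "?y \<in> carrier (free_group (arcs m D))"
    using assms by (intro gen_closed next_arc_in_arcs)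
  have x: "gen (i, Suc j) \<in> carrier (free_group (arcs m D))"
    using Suc.prems assms j by (intro gen_closed) (simp_all add: under_arc_in_arcs)
  have x1: "gen (i, 1) \<in> carrier (free_group (arcs m D))"
    using assms by (intro gen_closed first_arc_in_arcs)
  have v: "?v \<in> carrier (free_group (arcs m D))"
    using Suc.prems assms diagram by (intro partial_longitude_closed) auto
  let ?r = "inv\<^bsub>free_group (arcs m D)\<^esub> ?y \<otimes>\<^bsub>free_group (arcs m D)\<^esub>
        ((?u [^]\<^bsub>free_group (arcs m D)\<^esub> (- ?e)) \<otimes>\<^bsub>free_group (arcs m D)\<^esub> gen (i, Suc j)
          \<otimes>\<^bsub>free_group (arcs m D)\<^esub> (?u [^]\<^bsub>free_group (arcs m D)\<^esub> ?e))"
  have "?r \<in> wirtinger_relators m D"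
    using assms Suc.prems unfolding wirtinger_relators_def Let_def
    by (intro CollectI exI[of _ i] exI[of _ "Suc j"]) auto
  then have "\<one> = \<theta> ?r" by (simp add: relators)
  also have "\<theta> ?r = inv (\<theta> ?y) \<otimes> (inv ?U \<otimes> \<theta> (gen (i, Suc j)) \<otimes> ?U)"
    using u x y by (simp add: hom_int_pow H.int_pow_neg G.int_pow_neg)
  finally have "\<theta> ?y = inv ?U \<otimes> \<theta> (gen (i, Suc j)) \<otimes> ?U"
    using u x y by (simp add: H.inv_solve_left)
  also have "\<theta> (gen (i, Suc j)) = inv (\<theta> ?v) \<otimes> \<theta> (gen (i, 1)) \<otimes> \<theta> ?v"
    using Suc j by simp
  also have "inv ?U \<otimes> \<dots> \<otimes> ?U = inv (\<theta> ?v \<otimes> ?U) \<otimes> \<theta> (gen (i, 1)) \<otimes> (\<theta> ?v \<otimes> ?U)"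
    using u v hom_closed[OF x1] by (simp add: H.m_assoc H.inv_mult_group)
  also have "\<theta> ?v \<otimes> ?U = \<theta> (partial_longitude m D i (Suc j))"
    using u v by (simp add: hom_int_pow)
  finally show ?case by (simp add: next_arc_def)
qed

lemma longitude_commutes:
  assumes "1 \<le> i" "i \<le> m"
  shows "inv (\<theta> (longitude m D i)) \<otimes> \<theta> (gen (i, 1)) \<otimes> \<theta> (longitude m D i) = \<theta> (gen (i, 1))"
proof -
  \<comment> \<open>Either both numbers agree, or there is no under-crossing and this is 0 modulo
    1.\<close>
  have "num_under m D i mod num_arcs m D i = 0" by (simp add: num_arcs_def max_def)
  then show ?thesis
    using arc_image[OF assms order_refl, symmetric] by (simp only: longitude_def add_0)
qed

lemma longitude_closed:
  "1 \<le> i \<Longrightarrow> i \<le> m \<Longrightarrow> longitude m D i \<in> carrier (free_group (arcs m D))"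
  unfolding longitude_def using diagram by (intro partial_longitude_closed) auto

lemma first_arc_image_closed: "(\<lambda>i. \<theta> (gen (i, 1))) \<in> {1..m} \<rightarrow> carrier G"
  by (auto intro!: hom_closed gen_closed first_arc_in_arcs simp del: One_nat_def)

text \<open>This is the map \<phi> that sends the generator \<alpha> with index \<open>i\<close> to
  the image of the first arc of component \<open>i\<close>.\<close>

sublocale lift: group_hom "F_alpha m" G "free_lift G (\<lambda>i. \<theta> (gen (i, 1)))"
  by (intro group_hom_free_lift H.is_group first_arc_image_closed)

lemma lift_gen: "1 \<le> i \<Longrightarrow> i \<le> m \<Longrightarrow> free_lift G (\<lambda>i. \<theta> (gen (i, 1))) (gen i) = \<theta> (gen (i, 1))"
  using first_arc_image_closed by (intro H.free_lift_gen) auto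

text \<open>Modulo the lower central term both sides are homomorphisms in \<open>w\<close>, so arcs
  suffice. There both are conjugates of the image of the first arc, by elements that agree one term
  earlier by induction; \<open>conj_mod_lower_central\<close> applies.\<close>

lemma eta_mod_lower_central:
  assumes "w \<in> carrier (free_group (arcs m D))"
  shows "lower_central G (Suc q) #> free_lift G (\<lambda>i. \<theta> (gen (i, 1))) (eta m D (Suc q) w) =
    lower_central G (Suc q) #> \<theta> w"
  using assms
proof (induction q arbitrary: w)
  case 0
  interpret e: group_hom "free_group (arcs m D)" "F_alpha m" "eta m D (Suc 0)"
    using diagram by (intro group_hom_eta) auto
  \<comment> \<open>The first term is the whole group, so all cosets are equal.\<close>
  show ?case using 0 by (simp add: H.coset_join2 H.subgroup_self del: One_nat_def)
next
  case (Suc q)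
  let ?\<phi> = "free_lift G (\<lambda>i. \<theta> (gen (i, 1)))"
  define L where "L = lower_central G (Suc (Suc q))"
  interpret L: normal L G unfolding L_def by (rule H.lower_central_normal)
  interpret p: group_hom G "G Mod L" "\<lambda>x. L #> x" by (rule L.group_hom_Mod)
  interpret e: group_hom "free_group (arcs m D)" "F_alpha m" "eta m D (Suc q)"
    using diagram by (intro group_hom_eta) auto
  interpret e': group_hom "free_group (arcs m D)" "F_alpha m" "eta m D (Suc (Suc q))"
    using diagram by (intro group_hom_eta) auto
  have "((\<lambda>x. L #> x) \<circ> (?\<phi> \<circ> eta m D (Suc (Suc q)))) w = ((\<lambda>x. L #> x) \<circ> \<theta>) w"
  proof (rule free_group_hom_eq[OF p.H.is_group _ _ _ Suc.prems])
    show "(\<lambda>x. L #> x) \<circ> (?\<phi> \<circ> eta m D (Suc (Suc q))) \<in> hom (free_group (arcs m D)) (G Mod L)"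
      by (intro Group.hom_compose[OF _ p.homh] Group.hom_compose[OF e'.homh lift.homh])
    show "(\<lambda>x. L #> x) \<circ> \<theta> \<in> hom (free_group (arcs m D)) (G Mod L)"
      by (intro Group.hom_compose[OF _ p.homh] homh)
    fix x assume x: "x \<in> arcs m D"
    obtain i j where ij: "x = (i, j)" "1 \<le> i" "i \<le> m" "1 \<le> j" "j \<le> num_arcs m D i"
      using x by (auto simp: arcs_def)
    have eta_x: "eta m D (Suc (Suc q)) (gen x) = eta_gen m D (Suc (Suc q)) x"
      unfolding eta_def using eta_gen_Pi[OF diagram, of "Suc (Suc q)"] x
      by (intro lift.G.free_lift_gen) auto
    have "L #> ?\<phi> (eta_gen m D (Suc (Suc q)) x) = L #> \<theta> (gen x)"
    proof (cases "j = 1")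
      case True
      then show ?thesis using ij lift_gen by simp
    next
      case False
      let ?v = "partial_longitude m D i (j - 1)"
      \<comment> \<open>For \<open>j > 1\<close> the cyclic index of \<open>arc_image\<close> at
        \<open>j - 1\<close> is \<open>j\<close> itself.\<close>
      have j: "j - 1 \<le> num_under m D i" "(j - 1) mod num_arcs m D i + 1 = j"
        using ij False by (auto simp: num_arcs_def)
      have v: "?v \<in> carrier (free_group (arcs m D))"
        using diagram ij(2,3) j(1) by (intro partial_longitude_closed)
      have x1: "\<theta> (gen (i, 1)) \<in> carrier G" using first_arc_image_closed ij by auto
      have "eta_gen m D (Suc (Suc q)) x = inv\<^bsub>F_alpha m\<^esub> (eta m D (Suc q) ?v) \<otimes>\<^bsub>F_alpha m\<^esub>
          gen i \<otimes>\<^bsub>F_alpha m\<^esub> eta m D (Suc q) ?v"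
        using False ij(1) e.hom_inv[OF v] by (simp add: eta_def)
      then have "?\<phi> (eta_gen m D (Suc (Suc q)) x) =
          inv (?\<phi> (eta m D (Suc q) ?v)) \<otimes> \<theta> (gen (i, 1)) \<otimes> ?\<phi> (eta m D (Suc q) ?v)"
        using v ij lift_gen[of i] by (simp add: gen_closed del: One_nat_def eta_gen.simps)
      moreover have "\<theta> (gen x) = inv (\<theta> ?v) \<otimes> \<theta> (gen (i, 1)) \<otimes> \<theta> ?v"
        using arc_image[OF ij(2,3) j(1)] by (simp only: ij(1) j(2))
      moreover have "L #> (inv (?\<phi> (eta m D (Suc q) ?v)) \<otimes> \<theta> (gen (i, 1)) \<otimes> ?\<phi> (eta m D (Suc q) ?v)) =
          L #> (inv (\<theta> ?v) \<otimes> \<theta> (gen (i, 1)) \<otimes> \<theta> ?v)"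
        unfolding L_def using Suc.IH[OF v] v x1
          by (intro H.conj_mod_lower_central) (auto simp del: One_nat_def)
      ultimately show ?thesis by simp
    qed
    then show "((\<lambda>x. L #> x) \<circ> (?\<phi> \<circ> eta m D (Suc (Suc q)))) (gen x) = ((\<lambda>x. L #> x) \<circ> \<theta>) (gen x)"
      by (simp only: o_apply eta_x)
  qed
  then show ?case by (simp add: L_def)
qed

end

section \<open>The trivial link\<close>

text \<open>All points of the diagram have height 0, so none lies strictly above another.\<close>

lemma under_params_trivial_link: "under_params m trivial_link i = {}"
  by (auto simp: under_params_def trivial_link_def)

lemma arcs_trivial_link: "arcs m trivial_link = {1..m} \<times> {1}"
  by (auto simp: arcs_def num_arcs_def num_under_def under_params_trivial_link)

lemma R4_trivial_link:
  "R4 m trivial_link = presented_group ({1..m} \<times> {1}) (S_words ({1..m} \<times> {1}))"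
  by (simp add: R4_def arcs_trivial_link wirtinger_relators_def Let_def num_under_def
      under_params_trivial_link)

section \<open>Triviality of the commutators\<close>

theorem lemma2p3:
  fixes n q m :: nat
    and L :: "nat \<Rightarrow> real \<Rightarrow> space4"
    and D :: diagram
  assumes "n \<ge> 1" and "q \<ge> 1"
    and "link m L" and "diagram_of m D L"
    and "R4 m D \<cong> R4 m trivial_link"
  shows "{commutator (F_alpha m) (gen i) (eta m D q (longitude m D i)) | i. 1 \<le> i \<and> i \<le> m}
    \<subseteq> subgroup_prod (F_alpha m)
        (subgroup_prod (F_alpha m)
          (normal_closure (F_alpha m) (S_words {1..m}))
          (normal_closure (F_alpha m) (W_words n {1..m})))
        (lower_central (F_alpha m) q)"
proof -

  \<comment> \<open>The normal subgroup \<open>N\<close>\<close>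
  define F where "F = F_alpha m"
  interpret F: group F unfolding F_def by (rule group_free_group)
  define NS where "NS = normal_closure F (S_words {1..m})"
  define NW where "NW = normal_closure F (W_words n {1..m})"
  define N where "N = subgroup_prod F (subgroup_prod F NS NW) (lower_central F q)"
  have NS: "NS \<lhd> F" and NW: "NW \<lhd> F"
    unfolding NS_def NW_def F_def using group.normal_closure_normal[OF group_free_group]
      S_words_closed W_words_closed by blast+
  note NSW = F.subgroup_prod_normal[OF NS NW]
  interpret N: normal N F
    unfolding N_def by (intro F.subgroup_prod_normal NSW F.lower_central_normal)
  have SN: "S_words {1..m} \<subseteq> N" and WN: "W_words n {1..m} \<subseteq> N"
    using F.subset_normal_closure[of "S_words {1..m}"] F.subset_normal_closure[of "W_words n {1..m}"]
      F.subset_subgroup_prod1[OF NS NW] F.subset_subgroup_prod2[OF NS NW]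
      F.subset_subgroup_prod1[OF NSW F.lower_central_normal[of q]]
    unfolding NS_def NW_def N_def by blast+
  have LN: "lower_central F q \<subseteq> N"
    unfolding N_def by (intro F.subset_subgroup_prod2 NSW F.lower_central_normal)

  \<comment> \<open>The quotient \<open>Q\<close> and its finiteness\<close>
  define Q where "Q = F Mod N"
  define \<pi> where "\<pi> = (\<lambda>x. N #>\<^bsub>F\<^esub> x)"
  interpret \<pi>: group_hom F Q \<pi> unfolding Q_def \<pi>_def by (rule N.group_hom_Mod)
  have \<pi>_onto: "\<pi> ` carrier F = carrier Q" by (simp add: Q_def \<pi>_def carrier_FactGroup)
  have \<pi>_one: "\<pi> x = \<one>\<^bsub>Q\<^esub>" if "x \<in> N" for x
    using that N.coset_eq_iff_one[of x] by (simp add: Q_def \<pi>_def)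
  have exponent: "g [^]\<^bsub>Q\<^esub> n = \<one>\<^bsub>Q\<^esub>" if g: "g \<in> carrier Q" for g
  proof -
    obtain w where w: "w \<in> carrier F" "g = \<pi> w" using g \<pi>_onto by blast
    then have "w [^]\<^bsub>F\<^esub> n \<in> N" using WN unfolding W_words_def F_def by blast
    then show ?thesis using w \<pi>_one \<pi>.hom_nat_pow[of w n] by simp
  qed
  have nilpotent: "lower_central Q q = {\<one>\<^bsub>Q\<^esub>}"
  proof -
    interpret C: normal "lower_central F q" F by (rule F.lower_central_normal)
    have "\<one>\<^bsub>Q\<^esub> \<in> \<pi> ` lower_central F q" using C.one_closed \<pi>.hom_one by (metis imageI)
    then show ?thesis
      unfolding \<pi>.lower_central_surj[OF \<pi>_onto] using LN \<pi>_one by auto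
  qed
  have gens: "gen ` {1..m} \<subseteq> carrier F" by (auto simp: F_def gen_closed)
  have "finite (carrier Q)"
  proof (rule \<pi>.H.finite_nilpotent_exponent[OF _ _ _ assms(1,2) exponent nilpotent])
    show "carrier Q = generate Q (\<pi> ` gen ` {1..m})"
      using \<pi>.generate_img[OF gens] \<pi>_onto carrier_free_group[of "{1..m}"] by (simp add: F_def)
    show "\<pi> ` gen ` {1..m} \<subseteq> carrier Q" using gens \<pi>_onto by blast
  qed simp_all

  \<comment> \<open>From the invariant of the trivial link onto \<open>Q\<close>\<close>
  define T where "T = {1..m} \<times> {1::nat}"
  \<comment> \<open>The arcs of the trivial diagram are the pairs \<open>(i, 1)\<close>;
    \<open>p\<close> renames them to the generators \<open>i\<close> of \<open>F\<close>.\<close>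
  define p where "p = free_lift F (\<lambda>x :: nat \<times> nat. gen (fst x))"
  interpret p: group_hom "free_group T" F p
    unfolding p_def using gens by (intro group_hom_free_lift F.is_group) (auto simp: T_def)
  have T_gens: "gen ` T \<subseteq> carrier (free_group T)" by (auto simp: gen_closed)
  have p_gen: "p (gen x) = gen (fst x)" if "x \<in> T" for x
    unfolding p_def using that gens by (intro F.free_lift_gen) (auto simp: T_def)
  have "p ` gen ` T = gen ` fst ` T" by (simp add: image_image p_gen cong: image_cong)
  also have "fst ` T = {1..m}" by (simp add: T_def)
  finally have p_onto: "p ` carrier (free_group T) = carrier F"
    using p.generate_img[OF T_gens] carrier_free_group[of T] carrier_free_group[of "{1..m}"]
    by (simp add: F_def)
  have "(\<pi> \<circ> p) r = \<one>\<^bsub>Q\<^esub>" if "r \<in> S_words T" for r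
    using S_words_free_lift[of T fst "{1..m}" r] that SN \<pi>_one
    by (auto simp: p_def F_def T_def)
  then obtain g where g: "g \<in> hom (R4 m trivial_link) Q"
    "\<And>w. w \<in> carrier (free_group T) \<Longrightarrow>
      g (normal_closure (free_group T) (S_words T) #>\<^bsub>free_group T\<^esub> w) = (\<pi> \<circ> p) w"
    using presented_group_lift[OF \<pi>.H.is_group Group.hom_compose[OF p.homh \<pi>.homh] S_words_closed]
    unfolding R4_trivial_link T_def by blast
  have g_onto: "g ` carrier (R4 m trivial_link) = carrier Q"
  proof -
    have "g ` carrier (R4 m trivial_link) = (\<pi> \<circ> p) ` carrier (free_group T)"
      unfolding R4_trivial_link T_def[symmetric] presented_group_def carrier_FactGroup
      by (simp add: image_image g(2))
    then show ?thesis using p_onto \<pi>_onto by (simp only: image_comp[symmetric])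
  qed

  \<comment> \<open>The surjection \<theta> from F(X) onto \<open>Q\<close>\<close>
  have diagram: "link_diagram m D" using assms(4) by (simp add: diagram_of_def)
  define X where "X = arcs m D"
  define R where "R = wirtinger_relators m D \<union> S_words X"
  interpret X: group "free_group X" by (rule group_free_group)
  have R: "R \<subseteq> carrier (free_group X)"
    unfolding R_def X_def using wirtinger_relators_closed[OF diagram] S_words_closed by blast
  define K where "K = normal_closure (free_group X) R"
  interpret K: normal K "free_group X" unfolding K_def by (rule X.normal_closure_normal[OF R])
  have R4_D: "R4 m D = free_group X Mod K"
    by (simp add: R4_def presented_group_def X_def K_def R_def)
  obtain h where h: "h \<in> iso (R4 m D) (R4 m trivial_link)"
    using assms(5) by (auto simp: is_iso_def)
  \<comment> \<open>The composite of the projection to \<open>R4 m D\<close>, the given isomorphism,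
    and the surjection \<open>g\<close> onto \<open>Q\<close>.\<close>
  define \<theta> where "\<theta> = (g \<circ> h) \<circ> (\<lambda>w. K #>\<^bsub>free_group X\<^esub> w)"
  have gh: "g \<circ> h \<in> hom (free_group X Mod K) Q"
    using h g(1) unfolding R4_D by (intro Group.hom_compose) (auto simp: iso_def)
  then interpret gh: group_hom "free_group X Mod K" Q "g \<circ> h"
    by (intro group_hom.intro group_hom_axioms.intro K.factorgroup_is_group \<pi>.H.is_group)
  have \<theta>_relator: "\<theta> r = \<one>\<^bsub>Q\<^esub>" if "r \<in> R" for r
  proof -
    have "r \<in> K" using that X.subset_normal_closure by (auto simp: K_def)
    then have "K #>\<^bsub>free_group X\<^esub> r = \<one>\<^bsub>free_group X Mod K\<^esub>"
      using K.coset_eq_iff_one[of r] by simp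
    then show ?thesis using gh.hom_one by (simp add: \<theta>_def del: one_FactGroup)
  qed
  have "\<theta> \<in> hom (free_group X) Q"
    unfolding \<theta>_def by (intro Group.hom_compose[OF K.r_coset_hom_Mod gh])
  then interpret \<theta>: wirtinger_hom m D Q \<theta>
    using \<theta>_relator diagram unfolding X_def R_def
    by (intro wirtinger_hom.intro group_hom.intro group_hom_axioms.intro wirtinger_hom_axioms.intro
        group_free_group \<pi>.H.is_group) auto
  have \<theta>_onto: "\<theta> ` carrier (free_group X) = carrier Q"
  proof -
    have "h ` carrier (R4 m D) = carrier (R4 m trivial_link)"
      using h by (auto simp: iso_def bij_betw_def)
    then have "(g \<circ> h) ` carrier (free_group X Mod K) = carrier Q"
      using g_onto by (simp only: R4_D image_comp[symmetric])
    then show ?thesis by (simp add: \<theta>_def carrier_FactGroup image_comp)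
  qed

  \<comment> \<open>The map \<phi> from F(A) to \<open>Q\<close> and its kernel\<close>
  define \<phi> where "\<phi> = free_lift Q (\<lambda>i. \<theta> (gen (i, 1)))"
  interpret \<phi>: group_hom F Q \<phi>
    unfolding \<phi>_def F_def by (rule \<theta>.lift.group_hom_axioms)
  interpret \<eta>: group_hom "free_group X" F "eta m D q"
    unfolding X_def F_def by (rule group_hom_eta[OF diagram assms(2)])
  \<comment> \<open>Agreement modulo the \<open>q\<close>th lower central term of \<open>Q\<close>
    is equality, since that term is trivial.\<close>
  have \<phi>_eta: "\<phi> (eta m D q w) = \<theta> w" if w: "w \<in> carrier (free_group X)" for w
  proof -
    obtain q' where "q = Suc q'" using assms(2) by (cases q) auto
    then have "{\<one>\<^bsub>Q\<^esub>} #>\<^bsub>Q\<^esub> \<phi> (eta m D q w) = {\<one>\<^bsub>Q\<^esub>} #>\<^bsub>Q\<^esub> \<theta> w"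
      using \<theta>.eta_mod_lower_central[of w q'] w nilpotent by (simp add: \<phi>_def X_def)
    then show ?thesis using w X_def by (simp add: r_coset_def)
  qed
  have \<phi>_onto: "\<phi> ` carrier F = carrier Q"
  proof
    show "carrier Q \<subseteq> \<phi> ` carrier F"
      using \<theta>_onto \<phi>_eta \<eta>.hom_closed by (metis (no_types, lifting) image_iff subsetI)
  qed auto
  have "N \<subseteq> kernel F Q \<phi>"
    unfolding N_def
  proof (intro F.subgroup_prod_minimal)
    have "r \<in> kernel F Q \<phi>" if r: "r \<in> S_words {1..m}" for r
    proof -
      \<comment> \<open>\<iota> sends each generator to the first arc of its component, so \<phi> is
        \<theta> after \<iota>. It carries S(A) into S(X), which \<theta> kills.\<close>
      let ?\<iota> = "free_lift (free_group X) (\<lambda>i. gen (i, 1::nat))"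
      interpret \<iota>: group_hom F "free_group X" ?\<iota>
        unfolding F_def X_def
        by (intro group_hom_free_lift group_free_group)
          (auto intro!: gen_closed first_arc_in_arcs simp del: One_nat_def)
      have rF: "r \<in> carrier F" using r S_words_closed by (auto simp: F_def)
      have "?\<iota> r \<in> S_words X"
        using r unfolding X_def by (intro S_words_free_lift[of "{1..m}"])
          (auto intro: first_arc_in_arcs simp del: One_nat_def)
      then have "(\<theta> \<circ> ?\<iota>) r = \<one>\<^bsub>Q\<^esub>" using \<theta>_relator by (simp add: R_def)
      moreover have "\<phi> r = (\<theta> \<circ> ?\<iota>) r"
      proof (rule free_group_hom_eq[OF \<pi>.H.is_group])
        show "\<phi> \<in> hom (F_alpha m) Q" using \<phi>.homh by (simp add: F_def)
        show "\<theta> \<circ> ?\<iota> \<in> hom (F_alpha m) Q"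
          using \<iota>.homh \<theta>.homh unfolding F_def X_def by (rule Group.hom_compose)
        show "r \<in> carrier (F_alpha m)" using rF by (simp add: F_def)
        fix i assume i: "i \<in> {1..m}"
        then have "?\<iota> (gen i) = gen (i, 1)"
          unfolding X_def by (intro group.free_lift_gen group_free_group gen_closed first_arc_in_arcs) auto
        then show "\<phi> (gen i) = (\<theta> \<circ> ?\<iota>) (gen i)"
          using i \<theta>.lift_gen[of i] by (simp add: \<phi>_def)
      qed
      ultimately show ?thesis using rF by (simp add: kernel_def)
    qed
    then show "NS \<subseteq> kernel F Q \<phi>"
      unfolding NS_def by (intro F.normal_closure_minimal \<phi>.normal_kernel) blast
    have "w [^]\<^bsub>F\<^esub> n \<in> kernel F Q \<phi>" if "w \<in> carrier F" for w
      using that exponent[of "\<phi> w"] \<phi>.hom_nat_pow[of w n] by (simp add: kernel_def)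
    then show "NW \<subseteq> kernel F Q \<phi>"
      unfolding NW_def
      by (intro F.normal_closure_minimal \<phi>.normal_kernel) (auto simp: W_words_def F_def)
    have "lower_central F q \<subseteq> carrier F"
      using F.lower_central_normal by (intro subgroup.subset normal_imp_subgroup)
    \<comment> \<open>Surjectivity of \<phi> identifies this image with the trivial
      \<open>q\<close>th term of \<open>Q\<close>.\<close>
    moreover have "\<phi> ` lower_central F q = {\<one>\<^bsub>Q\<^esub>}"
      using \<phi>.lower_central_surj[OF \<phi>_onto, of q] nilpotent by simp
    ultimately show "lower_central F q \<subseteq> kernel F Q \<phi>"
      unfolding kernel_def by blast
  qed (rule \<phi>.subgroup_kernel)+
  then have kernel: "kernel F Q \<phi> = N"
    using N.kernel_eq_if_finite_Mod[of \<phi>] \<open>finite (carrier Q)\<close> \<phi>.homh \<phi>_onto by (simp add: Q_def)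

  \<comment> \<open>The commutators lie in the kernel of \<phi>\<close>
  have "commutator F (gen i) (eta m D q (longitude m D i)) \<in> N" if i: "1 \<le> i" "i \<le> m" for i
  proof -
    have l: "longitude m D i \<in> carrier (free_group X)"
      unfolding X_def by (rule \<theta>.longitude_closed[OF i])
    have gi: "gen i \<in> carrier F" using gens i by auto
    have "\<theta> (gen (i, 1)) \<in> carrier Q" using \<theta>.first_arc_image_closed i by auto
    then have "commutator Q (\<theta> (gen (i, 1))) (\<theta> (longitude m D i)) = \<one>\<^bsub>Q\<^esub>"
      using l \<theta>.longitude_commutes[OF i] by (intro \<pi>.H.commutator_eq_one) (auto simp: X_def)
    then have "\<phi> (commutator F (gen i) (eta m D q (longitude m D i))) = \<one>\<^bsub>Q\<^esub>"
      using \<phi>.hom_commutator[OF gi \<eta>.hom_closed[OF l]] \<phi>_eta[OF l] \<theta>.lift_gen[OF i]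
      by (simp add: \<phi>_def)
    then show ?thesis
      unfolding kernel[symmetric] using gi l by (simp add: kernel_def F.commutator_closed)
  qed
  then show ?thesis unfolding N_def NS_def NW_def F_def by blast
qed

end
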